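(* Let $\mathcal{F}$ be the set of all coefficient matrices of elements of $\mathcal{D}_0^t(\mathcal{I})$, where $\mathcal{I}=[0,1]$. Then $\mathcal{F}$ is an algebra of infinite matrices with respect to the usual sum, multiplication by scalars, and matrix product; in particular, for all $F,G\in\mathcal{F}$ the series defining the entries of the matrix product $FG$ converge and $FG\in\mathcal{F}$. Moreover, this algebra corresponds to the ring $(\mathcal{D}_0^t(\mathcal{I}),\star,+,0,1_\star)$: the map sending $f\in\mathcal{D}_0^t(\mathcal{I})$ to its coefficient matrix is a bijection onto $\mathcal{F}$ that sends $f+g$ to $F+G$, $f\star g$ to $FG$, and $1_\star$ to the identity matrix, where $F,G$ are the coefficient matrices of $f,g$.
   Context: $\Theta$ is the Heaviside function, $\Theta(t-s)=1$ if $t\ge s$ and $0$ if $t<s$. $\mathcal{A}_\Theta(\mathcal{I})$ is the set of $f(t,s)=\tilde f(t,s)\Theta(t-s)$ with $\tilde f$ analytic in both variables over $\mathcal{I}=[0,1]$, and $\mathcal{A}^t_\Theta(\mathcal{I})$ is the subset of those of the form $f(t,s)=\tilde f(t)\Theta(t-s)$. For $f,g\in\mathcal{A}_\Theta(\mathcal{I})$ the $\star$-product is $(f\star g)(t,s)=\int_{\mathcal{I}}f(t,\tau)g(\tau,s)\,d\tau=\Theta(t-s)\int_s^t\tilde f(t,\tau)\tilde g(\tau,s)\,d\tau$; it is extended bilinearly so that $1_\star(t,s)=\delta(t-s)$ (Dirac delta) is the identity. $\mathcal{D}_0^t(\mathcal{I})$ is the set of all $\alpha 1_\star+\sum_{i=1}^n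 g_{i,1}\star\cdots\star g_{i,m_i}$ with $\alpha\in\mathbb{C}$ and $g_{i,j}\in\mathcal{A}^t_\Theta(\mathcal{I})$. $\{p_k\}_{k\ge0}$ are the orthonormal shifted Legendre polynomials on $[0,1]$. The coefficient matrix of $f\in\mathcal{A}_\Theta(\mathcal{I})$ is the infinite matrix $F=[f_{k,\ell}]_{k,\ell\ge0}$ with $f_{k,\ell}=\int_{\mathcal{I}}\int_{\mathcal{I}}f(\tau,\rho)p_k(\tau)p_\ell(\rho)\,d\rho\,d\tau$. The coefficient matrix of $1_\star$ is the infinite identity matrix $I$, and that of $\alpha1_\star+f$ with $f\in\mathcal{A}_\Theta(\mathcal{I})$ is $\alpha I+F$. *)

theory Defs
  imports
    "HOL-Analysis.Analysis"
    "HOL-Computational_Algebra.Polynomial"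
    "HOL-Algebra.QuotRing"
    "HOL-Algebra.Algebraic_Closure_Type"
begin

type_synonym kernel = "real \<Rightarrow> real \<Rightarrow> complex"

type_synonym cmatrix = "nat \<Rightarrow> nat \<Rightarrow> complex"

abbreviation unit_ival :: "real set" where
  "unit_ival \<equiv> {0..1}"


subsection \<open>Kernels with a Heaviside factor\<close>

text \<open>
  Joint real-analyticity on the closed square, through local double power series. Points
  outside the square are ignored, so at its edges the expansions are one-sided; a power series
  converging on such a one-sided neighbourhood converges on a full one, so this is the same as
  being the restriction of a function that is analytic near the square.
\<close>

definition analytic_on_square :: "kernel \<Rightarrow> bool" where
  "analytic_on_square f \<longleftrightarrow>
    (\<forall>t0\<in>unit_ival. \<forall>s0\<in>unit_ival. \<exists>(a :: nat \<Rightarrow> nat \<Rightarrow> complex) r. r > 0 \<and>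
      (\<forall>t\<in>unit_ival. \<forall>s\<in>unit_ival. \<bar>t - t0\<bar> < r \<longrightarrow> \<bar>s - s0\<bar> < r \<longrightarrow>
        ((\<lambda>(i, j). a i j * of_real ((t - t0) ^ i * (s - s0) ^ j)) has_sum f t s) UNIV))"

definition heaviside :: "real \<Rightarrow> complex" where
  "heaviside x = (if x \<ge> 0 then 1 else 0)"

text \<open>
  Kernels are functions on the square. They are extended by \<open>0\<close> outside it, so that equality
  of kernels is equality of HOL functions.
\<close>

definition theta_kernel :: "kernel \<Rightarrow> kernel" where
  "theta_kernel f = (\<lambda>t s.
    if t \<in> unit_ival \<and> s \<in> unit_ival then f t s * heaviside (t - s) else 0)"

definition A_Theta :: "kernel set" where
  "A_Theta = {theta_kernel f | f. analytic_on_square f}"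

definition A_Theta_t :: "kernel set" where
  "A_Theta_t = {f \<in> A_Theta. \<exists>h :: real \<Rightarrow> complex. f = theta_kernel (\<lambda>t s. h t)}"

definition kstar :: "kernel \<Rightarrow> kernel \<Rightarrow> kernel" where
  "kstar f g = (\<lambda>t s. LBINT \<tau>:unit_ival. f t \<tau> * g \<tau> s)"

fun kstar_list :: "kernel list \<Rightarrow> kernel" where
  "kstar_list [g] = g"
| "kstar_list (g # h # gs) = kstar g (kstar_list (h # gs))"


subsection \<open>Generalised kernels\<close>

text \<open>
  A pair \<open>(\<alpha>, f)\<close> stands for \<open>\<alpha> 1\<^sub>\<star> + f\<close>, where \<open>1\<^sub>\<star> = \<delta>(t - s)\<close>. The Dirac delta is not a
  function, so the pair is determined by the generalised kernel.
\<close>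

type_synonym gkernel = "complex \<times> kernel"

definition gone :: gkernel where
  "gone = (1, \<lambda>t s. 0)"

definition gzero :: gkernel where
  "gzero = (0, \<lambda>t s. 0)"

definition gadd :: "gkernel \<Rightarrow> gkernel \<Rightarrow> gkernel" where
  "gadd = (\<lambda>(\<alpha>, f) (\<beta>, g). (\<alpha> + \<beta>, \<lambda>t s. f t s + g t s))"

definition gstar :: "gkernel \<Rightarrow> gkernel \<Rightarrow> gkernel" where
  "gstar = (\<lambda>(\<alpha>, f) (\<beta>, g). (\<alpha> * \<beta>, \<lambda>t s. \<alpha> * g t s + \<beta> * f t s + kstar f g t s))"

definition D0t :: "gkernel set" where
  "D0t = {(\<alpha>, \<lambda>t s. \<Sum>i<n. kstar_list (gs i) t s) | \<alpha> (n :: nat) gs.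
            \<forall>i<n. gs i \<noteq> [] \<and> set (gs i) \<subseteq> A_Theta_t}"

definition D0t_ring :: "gkernel ring" where
  "D0t_ring = \<lparr>carrier = D0t, mult = gstar, one = gone, zero = gzero, add = gadd\<rparr>"


subsection \<open>Coefficient matrices\<close>

text \<open>
  Rodrigues' formula: with \<open>P\<^sub>k\<close> the classical Legendre polynomial, the shifted polynomial
  \<open>P\<^sub>k(2 x - 1)\<close> is the \<open>k\<close>-th derivative of \<open>(x\<^sup>2 - x)\<^sup>k / k!\<close>, and it has squared \<open>L\<^sup>2\<close> norm
  \<open>1 / (2 k + 1)\<close> on the unit interval.
\<close>

definition shifted_legendre :: "nat \<Rightarrow> real poly" where
  "shifted_legendre k =
    Polynomial.smult (sqrt (2 * real k + 1) / fact k) ((pderiv ^^ k) ([:0, -1, 1:] ^ k))"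

definition kernel_coeffs :: "kernel \<Rightarrow> cmatrix" where
  "kernel_coeffs f = (\<lambda>k l. LBINT \<tau>:unit_ival. LBINT \<rho>:unit_ival.
     f \<tau> \<rho> * of_real (poly (shifted_legendre k) \<tau>) * of_real (poly (shifted_legendre l) \<rho>))"

definition mat_one :: cmatrix where
  "mat_one = (\<lambda>k l. if k = l then 1 else 0)"

definition coeff_matrix :: "gkernel \<Rightarrow> cmatrix" where
  "coeff_matrix = (\<lambda>(\<alpha>, f) k l. \<alpha> * mat_one k l + kernel_coeffs f k l)"

definition coeff_matrices :: "cmatrix set" where
  "coeff_matrices = coeff_matrix ` D0t"

definition mat_mult :: "cmatrix \<Rightarrow> cmatrix \<Rightarrow> cmatrix" where
  "mat_mult F G = (\<lambda>k l. \<Sum>j. F k j * G j l)"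

definition coeff_matrix_algebra :: "(complex, cmatrix) module" where
  "coeff_matrix_algebra =
    \<lparr>carrier = coeff_matrices, mult = mat_mult, one = mat_one,
     zero = (\<lambda>k l. 0), add = (\<lambda>F G k l. F k l + G k l),
     smult = (\<lambda>c F k l. c * F k l)\<rparr>"


subsection \<open>Associative unital algebras\<close>

text \<open>
  The locale \<open>algebra\<close> of HOL-Algebra requires a commutative multiplication and is therefore
  too strong here.
\<close>

definition assoc_algebra :: "('a, 'm) ring_scheme \<Rightarrow> ('a, 'b, 'n) module_scheme \<Rightarrow> bool" where
  "assoc_algebra K A \<longleftrightarrow> Module.module K A \<and> Ring.ring A \<and>
    (\<forall>c\<in>carrier K. \<forall>x\<in>carrier A. \<forall>y\<in>carrier A.
      (c \<odot>\<^bsub>A\<^esub> x) \<otimes>\<^bsub>A\<^esub> y = c \<odot>\<^bsub>A\<^esub> (x \<otimes>\<^bsub>A\<^esub> y) \<and>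
      x \<otimes>\<^bsub>A\<^esub> (c \<odot>\<^bsub>A\<^esub> y) = c \<odot>\<^bsub>A\<^esub> (x \<otimes>\<^bsub>A\<^esub> y))"

end

theory Submission
  imports Defs
begin

text \<open>
  The proof works in the larger class of continuous Volterra kernels: functions that are continuous
  on the triangle \<open>0 \<le> s \<le> t \<le> 1\<close> and vanish off it. On this class \<open>\<star>\<close> is bilinear and, by Fubini's
  theorem, associative (\<open>kstar_assoc\<close>), and the product is again in the class (\<open>volterra_kstar\<close>).
  Sums of \<open>\<star>\<close>-products of kernels in \<open>A_Theta_t\<close> belong to it and are closed under sums,
  scalars and \<open>\<star>\<close>, so \<open>D0t\<close> is a ring.

  The coefficients of a kernel \<open>f\<close> are themselves values of \<open>\<star>\<close>-products: with
  \<open>r\<^sub>k(t, s) = p\<^sub>k(s) \<Theta>(t - s)\<close> and \<open>c\<^sub>l(t, s) = p\<^sub>l(t) \<Theta>(t - s)\<close>, the \<open>(k, l)\<close> coefficient is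
  \<open>(r\<^sub>k \<star> f \<star> c\<^sub>l)(1, 0)\<close> (\<open>kernel_coeffs_eq_kstar\<close>). Associativity therefore writes the coefficient
  of \<open>f \<star> g\<close> as the integral over \<open>[0, 1]\<close> of the product of \<open>(r\<^sub>k \<star> f)(1, x)\<close> and
  \<open>(g \<star> c\<^sub>l)(x, 0)\<close>. Both functions are continuous and their Legendre coefficients are the entries
  of the \<open>k\<close>-th row of the one matrix and of the \<open>l\<close>-th column of the other, so Parseval's identity
  states at once that the series for the matrix product converges and that its sum is the coefficient of
  \<open>f \<star> g\<close> (\<open>kernel_coeffs_kstar\<close>).

  The map is injective (\<open>coeff_matrix_eq_0\<close>) because polynomials are uniformly dense: if \<open>\<alpha> 1\<^sub>\<star> + f\<close>
  has zero coefficients, then \<open>\<integral>\<^sub>0\<^sup>t f(t, x) q(x) dx = - \<alpha> q(t)\<close> for all \<open>t\<close> and all polynomials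
  \<open>q\<close>. The choice \<open>t = 0\<close>, \<open>q = 1\<close> gives \<open>\<alpha> = 0\<close>, and then \<open>f(t, x)\<close> is orthogonal to all
  polynomials on \<open>[0, t]\<close> and vanishes. The algebra laws for matrices follow from those for kernels.
\<close>

section \<open>Orthonormality of the shifted Legendre polynomials\<close>

definition poly_integral :: "real poly \<Rightarrow> real" where
  "poly_integral p = integral {0..1} (poly p)"

lemma poly_integrable [simp]: "poly p integrable_on {a..b::real}"
  by (intro integrable_continuous_interval continuous_intros)

lemma poly_integral_add: "poly_integral (p + q) = poly_integral p + poly_integral q"
  using integral_add[of "poly p" "{0..1}" "poly q"] by (simp add: poly_integral_def poly_add[abs_def])

lemma poly_integral_smult: "poly_integral (Polynomial.smult c p) = c * poly_integral p"
  by (simp add: poly_integral_def poly_smult[abs_def])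

lemma poly_integral_diff: "poly_integral (p - q) = poly_integral p - poly_integral q"
  using poly_integral_add[of "p - q" q] by simp

lemma poly_integral_0: "poly_integral 0 = 0"
  using poly_integral_smult[of 0 0] by simp

lemma poly_integral_pderiv: "poly_integral (pderiv p) = poly p 1 - poly p 0"
  unfolding poly_integral_def
proof (intro integral_unique fundamental_theorem_of_calculus)
  fix x :: real
  show "(poly p has_vector_derivative poly (pderiv p) x) (at x within {0..1})"
    using poly_DERIV[of p x] DERIV_subset has_real_derivative_iff_has_vector_derivative by blast
qed simp

lemma poly_integral_by_parts:
  assumes "poly p 0 = 0" "poly p 1 = 0"
  shows "poly_integral (pderiv p * q) = - poly_integral (p * pderiv q)"
proof -
  have "poly_integral (pderiv (p * q)) = 0"
    using assms by (simp add: poly_integral_pderiv)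
  then have "poly_integral (p * pderiv q) + poly_integral (q * pderiv p) = 0"
    by (simp only: pderiv_mult poly_integral_add)
  then show ?thesis
    by (simp add: mult.commute[of q])
qed

text \<open>
  Rodrigues' formula presents \<open>p\<^sub>k\<close> as a \<open>k\<close>-th derivative, so integrating by parts \<open>k\<close> times
  moves all these derivatives to the other factor.
\<close>

lemma poly_integral_by_parts_iterated:
  assumes "\<And>m. m < k \<Longrightarrow> poly ((pderiv ^^ m) p) 0 = 0 \<and> poly ((pderiv ^^ m) p) 1 = 0"
  shows "poly_integral ((pderiv ^^ k) p * q) = (-1) ^ k * poly_integral (p * (pderiv ^^ k) q)"
  using assms
proof (induction k arbitrary: q)
  case (Suc k)
  have "poly_integral ((pderiv ^^ Suc k) p * q) = - poly_integral ((pderiv ^^ k) p * pderiv q)"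
    using poly_integral_by_parts[of "(pderiv ^^ k) p" q] Suc.prems[of k]
    by (simp only: funpow.simps o_apply lessI)
  also have "\<dots> = - ((-1) ^ k * poly_integral (p * (pderiv ^^ k) (pderiv q)))"
    using Suc.IH[of "pderiv q"] Suc.prems by simp
  finally show ?case
    by (simp only: funpow_Suc_right[of k pderiv] o_apply power_Suc mult_minus_left mult_1)
qed simp

lemma power_dvd_pderiv:
  fixes p r :: "real poly"
  assumes "r ^ Suc n dvd p"
  shows "r ^ n dvd pderiv p"
proof -
  obtain s where "p = r ^ Suc n * s" using assms by (elim dvdE)
  then have "pderiv p = r ^ n * (r * pderiv s + s * Polynomial.smult (of_nat (Suc n)) (pderiv r))"
    by (simp add: pderiv_mult pderiv_power_Suc algebra_simps del: of_nat_Suc power_Suc)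
       (simp add: algebra_simps)
  then show ?thesis by simp
qed

lemma power_dvd_higher_pderiv:
  fixes r :: "real poly"
  assumes "m \<le> k"
  shows "r ^ (k - m) dvd (pderiv ^^ m) (r ^ k)"
  using assms
proof (induction m)
  case (Suc m)
  then have "r ^ Suc (k - Suc m) dvd (pderiv ^^ m) (r ^ k)"
    by (simp add: Suc_diff_Suc del: power_Suc)
  then show ?case using power_dvd_pderiv by auto
qed simp

text \<open>
  Each of the points \<open>0\<close> and \<open>1\<close> is a \<open>k\<close>-fold zero of \<open>(x\<^sup>2 - x)\<^sup>k\<close>, and a derivative lowers
  the multiplicity of a zero by one; hence no boundary terms appear.
\<close>

lemma rodrigues_boundary:
  assumes "m < k" "x \<in> {0, 1::real}"
  shows "poly ((pderiv ^^ m) ([:0, -1, 1:] ^ k)) x = 0"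
proof -
  have "[:0, -1, 1:] ^ (k - m) dvd (pderiv ^^ m) ([:0, -1, 1::real:] ^ k)"
    using assms by (intro power_dvd_higher_pderiv) auto
  then obtain s where "(pderiv ^^ m) ([:0, -1, 1:] ^ k) = [:0, -1, 1::real:] ^ (k - m) * s"
    by (elim dvdE)
  then show ?thesis using assms by (auto simp: poly_power)
qed

text \<open>
  The Beta integral at integer arguments, needed for the norm of \<open>p\<^sub>k\<close>; integrating the derivative
  of \<open>x\<^sup>m\<^sup>+\<^sup>1 (1 - x)\<^sup>n\<^sup>+\<^sup>1\<close> trades one power of \<open>1 - x\<close> for one of \<open>x\<close>.
\<close>

lemma poly_integral_beta:
  "poly_integral ([:0, 1:] ^ m * [:1, -1:] ^ n) = fact m * fact n / fact (m + n + 1)"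
proof (induction n arbitrary: m)
  case 0
  have "pderiv ([:0, 1:] ^ Suc m :: real poly) = Polynomial.smult (real (Suc m)) ([:0, 1:] ^ m)"
    by (simp add: pderiv_power_Suc pderiv_pCons del: power_Suc)
  then have "real (Suc m) * poly_integral ([:0, 1:] ^ m) = 1"
    using poly_integral_pderiv[of "[:0, 1:] ^ Suc m"] by (simp add: poly_integral_smult poly_power)
  then have "poly_integral ([:0, 1:] ^ m) = 1 / real (Suc m)"
    by (simp only: eq_divide_eq mult.commute) simp
  then show ?case by simp
next
  case (Suc n)
  have 1: "pderiv ([:0, 1:] ^ Suc m :: real poly) = Polynomial.smult (real (Suc m)) ([:0, 1:] ^ m)"
    by (simp add: pderiv_power_Suc pderiv_pCons del: power_Suc)
  have 2: "pderiv ([:1, -1:] ^ Suc n :: real poly) = Polynomial.smult (- real (Suc n)) ([:1, -1:] ^ n)"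
    by (simp add: pderiv_power_Suc pderiv_pCons del: power_Suc)
  have "poly_integral (pderiv ([:0, 1:] ^ Suc m * [:1, -1:] ^ Suc n)) = 0"
    by (simp add: poly_integral_pderiv poly_power)
  then have "real (Suc m) * poly_integral ([:0, 1:] ^ m * [:1, -1:] ^ Suc n)
      = real (Suc n) * poly_integral ([:0, 1:] ^ Suc m * [:1, -1:] ^ n)"
    by (simp add: pderiv_mult 1 2 poly_integral_diff poly_integral_smult mult.commute
          del: power_Suc of_nat_Suc)
  also have "\<dots> = real (Suc n) * (fact (Suc m) * fact n / fact (m + n + 2))"
    by (simp only: Suc.IH add_Suc add_Suc_right numeral_2_eq_2 One_nat_def)
  also have "\<dots> = real (Suc m) * (fact m * fact (Suc n) / fact (m + Suc n + 1))"
    by (simp only: fact_Suc[of m] fact_Suc[of n] add_Suc add_Suc_right numeral_2_eq_2 One_nat_def) simp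
  finally show ?case
    by (simp only: mult_cancel_left of_nat_eq_0_iff) simp
qed

lemma degree_shifted_legendre: "Polynomial.degree (shifted_legendre k) = k"
  by (simp add: shifted_legendre_def degree_higher_pderiv degree_power_eq)

lemma shifted_legendre_0: "shifted_legendre 0 = 1"
  by (simp add: shifted_legendre_def)

text \<open>
  The polynomial \<open>(x\<^sup>2 - x)\<^sup>k\<close> is monic of degree \<open>2 k\<close>, so only its leading term survives
  \<open>2 k\<close> derivatives.
\<close>

lemma higher_pderiv_rodrigues:
  "(pderiv ^^ k) ((pderiv ^^ k) ([:0, -1, 1::real:] ^ k)) = [:fact (2 * k):]"
proof -
  let ?w = "[:0, -1, 1::real:] ^ k"
  have deg: "Polynomial.degree ?w = 2 * k" by (simp add: degree_power_eq)
  have lc: "Polynomial.coeff ?w (2 * k) = 1"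
    using deg lead_coeff_power[of "[:0, -1, 1::real:]" k] by simp
  have "(pderiv ^^ k) ((pderiv ^^ k) ?w) = (pderiv ^^ (2 * k)) ?w"
    by (simp add: funpow_add mult_2)
  also have "\<dots> = [:Polynomial.coeff ((pderiv ^^ (2 * k)) ?w) 0:]"
    using degree_higher_pderiv[of "2 * k" ?w] deg
    by (metis degree_eq_zeroE diff_self_eq_0 pCons_0_0 coeff_pCons_0)
  also have "Polynomial.coeff ((pderiv ^^ (2 * k)) ?w) 0 = fact (2 * k)"
    by (simp add: coeff_higher_pderiv lc pochhammer_fact[symmetric])
  finally show ?thesis .
qed

text \<open>
  After \<open>k\<close> integrations by parts the other factor has been differentiated \<open>k\<close> times, more often
  than its degree.
\<close>

lemma shifted_legendre_orthogonal:
  assumes "Polynomial.degree q < k"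
  shows "poly_integral (shifted_legendre k * q) = 0"
proof -
  have "(pderiv ^^ k) q = 0"
  proof (rule poly_eqI)
    fix n show "Polynomial.coeff ((pderiv ^^ k) q) n = Polynomial.coeff 0 n"
      using assms by (simp add: coeff_higher_pderiv coeff_eq_0)
  qed
  then have "poly_integral ((pderiv ^^ k) ([:0, -1, 1:] ^ k) * q) = 0"
    using poly_integral_by_parts_iterated[of k "[:0, -1, 1:] ^ k" q] rodrigues_boundary
    by (simp add: poly_integral_0)
  then show ?thesis
    by (simp add: shifted_legendre_def poly_integral_smult)
qed

lemma poly_integral_rodrigues: 
  "poly_integral ([:0, -1, 1:] ^ k) = (-1) ^ k * (fact k * fact k / fact (2 * k + 1))"
proof -
  have "[:0, -1, 1::real:] = Polynomial.smult (-1) ([:0, 1:] * [:1, -1:])" by simp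
  then have "[:0, -1, 1::real:] ^ k = Polynomial.smult ((-1) ^ k) ([:0, 1:] ^ k * [:1, -1:] ^ k)"
    using smult_power[of "-1::real" "[:0, 1:] * [:1, -1:]" k]
      power_mult_distrib[of "[:0, 1:]" "[:1, -1::real:]" k] by (simp only:)
  then show ?thesis
    using poly_integral_beta[of k k] by (simp only: poly_integral_smult mult_2)
qed

lemma shifted_legendre_normalized:
  "poly_integral (shifted_legendre k * shifted_legendre k) = 1"
proof -
  let ?w = "[:0, -1, 1::real:] ^ k"
  define c where "c = sqrt (2 * real k + 1) / fact k"
  have c2: "c * c = (2 * real k + 1) / (fact k * fact k)"
    by (simp add: c_def)
  have "poly_integral ((pderiv ^^ k) ?w * (pderiv ^^ k) ?w)
      = (-1) ^ k * poly_integral (?w * (pderiv ^^ k) ((pderiv ^^ k) ?w))"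
    by (intro poly_integral_by_parts_iterated) (auto intro: rodrigues_boundary)
  also have "\<dots> = (-1) ^ k * (fact (2 * k) * poly_integral ?w)"
    by (simp add: higher_pderiv_rodrigues poly_integral_smult)
  also have "\<dots> = fact (2 * k) * (fact k * fact k / fact (2 * k + 1))"
  proof -
    have "x * (y * (x * z)) = (x * x) * (y * z)" for x y z :: real by simp
    moreover have "(-1) ^ k * (-1) ^ k = (1::real)" by (simp flip: power_mult_distrib)
    ultimately show ?thesis by (simp only: poly_integral_rodrigues mult_1)
  qed
  also have "\<dots> = fact k * fact k / (2 * real k + 1)"
    by simp
  finally have "poly_integral ((pderiv ^^ k) ?w * (pderiv ^^ k) ?w) = fact k * fact k / (2 * real k + 1)" .
  moreover have "poly_integral (shifted_legendre k * shifted_legendre k)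
      = c * c * poly_integral ((pderiv ^^ k) ?w * (pderiv ^^ k) ?w)"
    by (simp add: shifted_legendre_def c_def poly_integral_smult)
  moreover have "2 * real k + 1 \<noteq> 0" by linarith
  ultimately have "poly_integral (shifted_legendre k * shifted_legendre k)
      = (2 * real k + 1) / (fact k * fact k) * (fact k * fact k / (2 * real k + 1))"
    by (simp only: c2)
  with \<open>2 * real k + 1 \<noteq> 0\<close> show ?thesis by simp
qed

lemma shifted_legendre_orthonormal:
  "poly_integral (shifted_legendre k * shifted_legendre l) = (if k = l then 1 else 0)"
proof (cases k l rule: linorder_cases)
  case less
  then show ?thesis
    using shifted_legendre_orthogonal[of "shifted_legendre k" l]
    by (simp add: degree_shifted_legendre mult.commute[of "shifted_legendre l"])
next
  case equal
  then show ?thesis using shifted_legendre_normalized by simp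
next
  case greater
  then show ?thesis
    using shifted_legendre_orthogonal[of "shifted_legendre l" k]
    by (simp add: degree_shifted_legendre)
qed

text \<open>
  Triangularity: \<open>p\<^sub>n\<close> has degree exactly \<open>n\<close>, so a multiple of it removes the leading term.
\<close>

lemma poly_legendre_expansion:
  assumes "Polynomial.degree q < n"
  shows "\<exists>b. q = (\<Sum>j<n. Polynomial.smult (b j) (shifted_legendre j))"
  using assms
proof (induction n arbitrary: q)
  case (Suc n)
  let ?P = "shifted_legendre n"
  have "?P \<noteq> 0"
    using shifted_legendre_normalized[of n] by (auto simp: poly_integral_0)
  then have nz: "Polynomial.coeff ?P n \<noteq> 0"
    using leading_coeff_neq_0[of ?P] by (simp add: degree_shifted_legendre)
  define c where "c = Polynomial.coeff q n / Polynomial.coeff ?P n"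
  define r where "r = q - Polynomial.smult c ?P"
  have r0: "Polynomial.coeff r i = 0" if "i \<ge> n" for i
  proof (cases "i = n")
    case True
    then show ?thesis using nz by (simp add: r_def c_def)
  next
    case False
    then have "Polynomial.coeff q i = 0" "Polynomial.coeff ?P i = 0"
      using that Suc.prems by (auto intro!: coeff_eq_0 simp: degree_shifted_legendre)
    then show ?thesis by (simp add: r_def)
  qed
  have "\<exists>b. r = (\<Sum>j<n. Polynomial.smult (b j) (shifted_legendre j))"
  proof (cases "r = 0")
    case True
    then show ?thesis by (intro exI[of _ "\<lambda>_. 0"]) simp
  next
    case False
    then have "Polynomial.degree r < n"
      using r0[of "Polynomial.degree r"] leading_coeff_neq_0[of r] by linarith
    then show ?thesis by (rule Suc.IH)
  qed
  then obtain b where b: "r = (\<Sum>j<n. Polynomial.smult (b j) (shifted_legendre j))" ..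
  have "(\<Sum>j<Suc n. Polynomial.smult ((b(n := c)) j) (shifted_legendre j))
      = (\<Sum>j<n. Polynomial.smult (b j) (shifted_legendre j)) + Polynomial.smult c ?P"
    by simp
  also have "\<dots> = q" by (simp only: b[symmetric] r_def diff_add_cancel)
  finally show ?case by (intro exI[of _ "b(n := c)"]) (rule sym)
qed simp


section \<open>Completeness and Parseval's identity\<close>

lemma poly_integral_sum: "poly_integral (sum f A) = (\<Sum>i\<in>A. poly_integral (f i))"
  by (induction A rule: infinite_finite_induct) (simp_all add: poly_integral_0 poly_integral_add)

lemma integral_legendre_sum:
  fixes g :: "real \<Rightarrow> 'a::euclidean_space"
  assumes "continuous_on {a..b} g"
  shows "integral {a..b} (\<lambda>x. poly (\<Sum>j<n. Polynomial.smult (c j) (shifted_legendre j)) x *\<^sub>R g x)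
    = (\<Sum>j<n. c j *\<^sub>R integral {a..b} (\<lambda>x. poly (shifted_legendre j) x *\<^sub>R g x))"
proof -
  have "(\<lambda>x. poly p x *\<^sub>R g x) integrable_on {a..b}" for p
    by (intro integrable_continuous_interval continuous_intros assms)
  then have "(\<lambda>x. c j *\<^sub>R (poly (shifted_legendre j) x *\<^sub>R g x)) integrable_on {a..b}" for j
    by (intro integrable_cmul)
  then have I: "integral {a..b} (\<lambda>x. \<Sum>j<n. c j *\<^sub>R (poly (shifted_legendre j) x *\<^sub>R g x))
    = (\<Sum>j<n. integral {a..b} (\<lambda>x. c j *\<^sub>R (poly (shifted_legendre j) x *\<^sub>R g x)))"
    by (intro integral_sum) auto
  have "poly (\<Sum>j<n. Polynomial.smult (c j) (shifted_legendre j)) x *\<^sub>R g x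
      = (\<Sum>j<n. c j *\<^sub>R (poly (shifted_legendre j) x *\<^sub>R g x))" for x
    by (simp add: poly_sum scaleR_sum_left)
  then show ?thesis
    by (simp only: I integral_cmul)
qed

lemma weierstrass_poly:
  fixes f :: "real \<Rightarrow> real"
  assumes "continuous_on {a..b} f" "e > 0"
  obtains q :: "real poly" where "\<And>x. x \<in> {a..b} \<Longrightarrow> \<bar>f x - poly q x\<bar> < e"
proof -
  obtain g where g: "real_polynomial_function g" "\<And>x. x \<in> {a..b} \<Longrightarrow> \<bar>f x - g x\<bar> < e"
    using Stone_Weierstrass_real_polynomial_function[OF compact_Icc assms] by blast
  obtain c n where "g = (\<lambda>x. \<Sum>i\<le>n. c i * x ^ i)"
    using g(1) real_polynomial_function_iff_sum by blast
  then have "g x = poly (\<Sum>i\<le>n. Polynomial.monom (c i) i) x" for x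
    by (simp add: poly_sum poly_monom)
  then show ?thesis using g(2) that by metis
qed

text \<open>
  By linearity \<open>g\<close> is orthogonal to all polynomials; approximating \<open>g\<close> uniformly by polynomials
  gives \<open>\<integral>g\<^sup>2 = 0\<close>. The interval is arbitrary because the kernels are tested on the intervals
  \<open>[0, t]\<close>, where the \<open>p\<^sub>k\<close> still span all polynomials although they are no longer orthogonal.
\<close>

lemma legendre_complete_real:
  fixes g :: "real \<Rightarrow> real"
  assumes cont: "continuous_on {a..b} g" and "a < b"
    and zero: "\<And>k. integral {a..b} (\<lambda>x. poly (shifted_legendre k) x * g x) = 0"
    and x: "x \<in> {a..b}"
  shows "g x = 0"
proof -
  define K where "K = integral {a..b} (\<lambda>x. \<bar>g x\<bar>)"
  define J where "J = integral {a..b} (\<lambda>x. g x * g x)"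
  have int: "(\<lambda>x. poly p x * g x) integrable_on {a..b}" for p
    by (intro integrable_continuous_interval continuous_intros cont)
  have int2: "(\<lambda>x. g x * g x) integrable_on {a..b}"
    by (intro integrable_continuous_interval continuous_intros cont)
  have "K \<ge> 0"
    unfolding K_def
    by (intro integral_nonneg integrable_continuous_interval continuous_intros cont) auto
  have poly0: "integral {a..b} (\<lambda>x. poly q x * g x) = 0" for q
  proof -
    obtain c where "q = (\<Sum>j<Suc (Polynomial.degree q). Polynomial.smult (c j) (shifted_legendre j))"
      using poly_legendre_expansion[of q "Suc (Polynomial.degree q)"] by auto
    then show ?thesis
      using integral_legendre_sum[OF cont, of c "Suc (Polynomial.degree q)"] zero by simp
  qed
  have bound: "J \<le> e * K" if "e > 0" for e
  proof -
    obtain q where q: "\<And>x. x \<in> {a..b} \<Longrightarrow> \<bar>g x - poly q x\<bar> < e"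
      using weierstrass_poly[OF cont \<open>e > 0\<close>] by blast
    have "J = integral {a..b} (\<lambda>x. g x * g x) - integral {a..b} (\<lambda>x. poly q x * g x)"
      by (simp add: J_def poly0)
    also have "\<dots> = integral {a..b} (\<lambda>x. g x * g x - poly q x * g x)"
      by (rule integral_diff[OF int2 int, symmetric])
    also have "\<dots> \<le> integral {a..b} (\<lambda>x. e * \<bar>g x\<bar>)"
    proof (rule integral_le)
      show "(\<lambda>x. g x * g x - poly q x * g x) integrable_on {a..b}"
        by (intro integrable_diff int int2)
      show "(\<lambda>x. e * \<bar>g x\<bar>) integrable_on {a..b}"
        by (intro integrable_continuous_interval continuous_intros cont)
      fix x assume "x \<in> {a..b}"
      have "g x * g x - poly q x * g x = (g x - poly q x) * g x" by (simp add: algebra_simps)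
      also have "\<dots> \<le> \<bar>(g x - poly q x) * g x\<bar>" by (rule abs_ge_self)
      also have "\<dots> \<le> e * \<bar>g x\<bar>"
        unfolding abs_mult using q[OF \<open>x \<in> {a..b}\<close>] by (intro mult_right_mono) auto
      finally show "g x * g x - poly q x * g x \<le> e * \<bar>g x\<bar>" .
    qed
    also have "\<dots> = e * K" by (simp add: K_def)
    finally show ?thesis .
  qed
  have "J \<le> 0"
  proof (rule field_le_epsilon)
    fix e :: real assume "e > 0"
    have "J \<le> e / (K + 1) * K" using \<open>K \<ge> 0\<close> \<open>e > 0\<close> by (intro bound) auto
    also have "\<dots> \<le> e" using \<open>K \<ge> 0\<close> \<open>e > 0\<close> by (simp add: divide_simps mult_left_mono)
    finally show "J \<le> 0 + e" by simp
  qed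
  moreover have "J \<ge> 0" unfolding J_def by (intro integral_nonneg int2) auto
  ultimately have "J = 0" by simp
  moreover have "J = 0 \<longleftrightarrow> (\<forall>x\<in>{a..b}. g x * g x = 0)"
    unfolding J_def by (intro integral_eq_0_iff continuous_intros cont \<open>a < b\<close>) auto
  ultimately show ?thesis using x by auto
qed

lemma legendre_complete:
  fixes g :: "real \<Rightarrow> 'a::euclidean_space"
  assumes cont: "continuous_on {a..b} g" and "a < b"
    and zero: "\<And>k. integral {a..b} (\<lambda>x. poly (shifted_legendre k) x *\<^sub>R g x) = 0"
    and x: "x \<in> {a..b}"
  shows "g x = 0"
proof (rule euclidean_eqI)
  fix i :: 'a assume "i \<in> Basis"
  have "integral {a..b} (\<lambda>x. poly (shifted_legendre k) x * (g x \<bullet> i)) = 0" for k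
  proof -
    have "(\<lambda>x. poly (shifted_legendre k) x *\<^sub>R g x) integrable_on {a..b}"
      by (intro integrable_continuous_interval continuous_intros cont)
    from integral_component_eq[OF this, of i] zero[of k] show ?thesis by simp
  qed
  moreover have "continuous_on {a..b} (\<lambda>x. g x \<bullet> i)"
    by (intro continuous_intros cont)
  ultimately show "g x \<bullet> i = 0 \<bullet> i"
    using legendre_complete_real[of a b "\<lambda>x. g x \<bullet> i" x] \<open>a < b\<close> x by simp
qed

definition legendre_coeff :: "(real \<Rightarrow> 'a::euclidean_space) \<Rightarrow> nat \<Rightarrow> 'a" where
  "legendre_coeff f j = integral {0..1} (\<lambda>x. poly (shifted_legendre j) x *\<^sub>R f x)"

lemma legendre_coeff_add:
  fixes f g :: "real \<Rightarrow> 'a::euclidean_space"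
  assumes "continuous_on {0..1} f" "continuous_on {0..1} g"
  shows "legendre_coeff (\<lambda>x. f x + g x) j = legendre_coeff f j + legendre_coeff g j"
proof -
  have "(\<lambda>x. poly (shifted_legendre j) x *\<^sub>R f x) integrable_on {0..1}"
    "(\<lambda>x. poly (shifted_legendre j) x *\<^sub>R g x) integrable_on {0..1}"
    by (intro integrable_continuous_interval continuous_intros assms)+
  then show ?thesis
    unfolding legendre_coeff_def scaleR_add_right by (rule integral_add)
qed

text \<open>
  The exact error of approximating \<open>f\<close> by a combination of \<open>p\<^sub>0, \<dots>, p\<^sub>n\<^sub>-\<^sub>1\<close>. With the Legendre
  coefficients as weights it yields Bessel's inequality, and with arbitrary weights it shows that
  these coefficients are the best possible.
\<close>

lemma legendre_square_error:
  fixes f :: "real \<Rightarrow> real"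
  assumes cont: "continuous_on {0..1} f"
  shows "integral {0..1} (\<lambda>x. (f x - poly (\<Sum>j<n. Polynomial.smult (b j) (shifted_legendre j)) x)\<^sup>2)
    = integral {0..1} (\<lambda>x. f x * f x) - (\<Sum>j<n. (legendre_coeff f j)\<^sup>2)
      + (\<Sum>j<n. (legendre_coeff f j - b j)\<^sup>2)"
proof -
  define q where "q = (\<Sum>j<n. Polynomial.smult (b j) (shifted_legendre j))"
  have 1: "(\<lambda>x. f x * f x) integrable_on {0..1}"
    by (intro integrable_continuous_interval continuous_intros cont)
  have 2: "(\<lambda>x. 2 * (poly q x * f x)) integrable_on {0..1}"
    by (intro integrable_continuous_interval continuous_intros cont)
  have fq: "integral {0..1} (\<lambda>x. poly q x * f x) = (\<Sum>j<n. b j * legendre_coeff f j)"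
    using integral_legendre_sum[OF cont, of b n] by (simp add: q_def legendre_coeff_def)
  have qP: "poly_integral (q * shifted_legendre j) = b j" if "j < n" for j
    using that by (simp add: q_def sum_distrib_right poly_integral_sum poly_integral_smult
        shifted_legendre_orthonormal if_distrib cong: if_cong)
  have qq: "poly_integral (q * q) = (\<Sum>j<n. b j * b j)"
  proof -
    have "poly_integral (q * q) = poly_integral (\<Sum>j<n. Polynomial.smult (b j) (q * shifted_legendre j))"
      by (subst (2) q_def) (simp add: sum_distrib_left)
    also have "\<dots> = (\<Sum>j<n. b j * b j)"
      by (simp add: poly_integral_sum poly_integral_smult qP)
    finally show ?thesis .
  qed
  have "integral {0..1} (\<lambda>x. (f x - poly q x)\<^sup>2)
      = integral {0..1} (\<lambda>x. f x * f x - 2 * (poly q x * f x) + poly (q * q) x)"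
    by (rule integral_cong) (simp add: power2_eq_square algebra_simps)
  also have "\<dots> = integral {0..1} (\<lambda>x. f x * f x) - 2 * integral {0..1} (\<lambda>x. poly q x * f x)
      + poly_integral (q * q)"
    by (simp add: integral_add integral_diff 1 2 integrable_diff poly_integral_def
        del: poly_mult)
  also have "\<dots> = integral {0..1} (\<lambda>x. f x * f x) - (\<Sum>j<n. (legendre_coeff f j)\<^sup>2)
      + (\<Sum>j<n. (legendre_coeff f j - b j)\<^sup>2)"
    unfolding fq qq
    by (simp add: power2_eq_square sum.distrib sum_subtractf sum_distrib_left algebra_simps)
  finally show ?thesis by (simp only: q_def)
qed

text \<open>
  The defect in Bessel's inequality is at most the squared error of any polynomial of degree less
  than \<open>n\<close>, and Weierstrass' theorem makes that error arbitrarily small.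
\<close>

lemma parseval_square:
  fixes f :: "real \<Rightarrow> real"
  assumes cont: "continuous_on {0..1} f"
  shows "(\<lambda>j. (legendre_coeff f j)\<^sup>2) sums integral {0..1} (\<lambda>x. f x * f x)"
  unfolding sums_def
proof (rule LIMSEQ_I)
  fix e :: real assume "e > 0"
  define N where "N = integral {0..1} (\<lambda>x. f x * f x)"
  define d where "d = sqrt (e / 2)"
  have "d > 0" using \<open>e > 0\<close> by (simp add: d_def)
  then obtain q where q: "\<And>x. x \<in> {0..1} \<Longrightarrow> \<bar>f x - poly q x\<bar> < d"
    using weierstrass_poly[OF cont] by blast
  have "norm ((\<Sum>j<n. (legendre_coeff f j)\<^sup>2) - N) < e" if n: "n \<ge> Suc (Polynomial.degree q)" for n
  proof -
    obtain b where b: "q = (\<Sum>j<n. Polynomial.smult (b j) (shifted_legendre j))"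
      using poly_legendre_expansion[of q n] n by auto
    have "0 \<le> integral {0..1} (\<lambda>x. (f x - poly (\<Sum>j<n. Polynomial.smult (legendre_coeff f j) (shifted_legendre j)) x)\<^sup>2)"
      by (intro integral_nonneg integrable_continuous_interval continuous_intros cont) auto
    then have "(\<Sum>j<n. (legendre_coeff f j)\<^sup>2) \<le> N"
      by (simp add: legendre_square_error[OF cont] N_def del: poly_sum)
    moreover have "N - (\<Sum>j<n. (legendre_coeff f j)\<^sup>2) \<le> integral {0..1} (\<lambda>x. (f x - poly q x)\<^sup>2)"
      by (subst b) (simp add: legendre_square_error[OF cont] N_def sum_nonneg)
    moreover have "integral {0..1} (\<lambda>x. (f x - poly q x)\<^sup>2) \<le> integral {0..1} (\<lambda>x::real. d\<^sup>2)"
    proof (rule integral_le)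
      show "(\<lambda>x. (f x - poly q x)\<^sup>2) integrable_on {0..1}"
        by (intro integrable_continuous_interval continuous_intros cont)
      fix x :: real assume "x \<in> {0..1}"
      from q[OF this] show "(f x - poly q x)\<^sup>2 \<le> d\<^sup>2"
        using \<open>d > 0\<close> by (simp add: abs_le_square_iff[symmetric])
    qed (rule integrable_const_ivl)
    moreover have "d\<^sup>2 < e" using \<open>e > 0\<close> by (simp add: d_def)
    ultimately show ?thesis by simp
  qed
  then show "\<exists>n0. \<forall>n\<ge>n0. norm ((\<Sum>j<n. (legendre_coeff f j)\<^sup>2) - N) < e" by blast
qed

text \<open>
  Polarisation of the previous identity.
\<close>

lemma parseval_real:
  fixes f g :: "real \<Rightarrow> real"
  assumes f: "continuous_on {0..1} f" and g: "continuous_on {0..1} g"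
  shows "(\<lambda>j. legendre_coeff f j * legendre_coeff g j) sums integral {0..1} (\<lambda>x. f x * g x)"
proof -
  have int: "(\<lambda>x. f x * g x) integrable_on {0..1}" "(\<lambda>x. f x * f x) integrable_on {0..1}"
    "(\<lambda>x. g x * g x) integrable_on {0..1}"
    by (intro integrable_continuous_interval continuous_intros f g)+
  have cfg: "continuous_on {0..1} (\<lambda>x. f x + g x)"
    by (intro continuous_intros f g)
  have lc: "legendre_coeff (\<lambda>x. f x + g x) j = legendre_coeff f j + legendre_coeff g j" for j
    by (rule legendre_coeff_add[OF f g])
  have "integral {0..1} (\<lambda>x. (f x + g x) * (f x + g x))
     = integral {0..1} (\<lambda>x. f x * f x + g x * g x + 2 * (f x * g x))"
    by (rule integral_cong) (simp add: algebra_simps)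
  also have "\<dots> = integral {0..1} (\<lambda>x. f x * f x) + integral {0..1} (\<lambda>x. g x * g x)
     + 2 * integral {0..1} (\<lambda>x. f x * g x)"
    by (simp add: integral_add int integrable_add)
  finally have I: "integral {0..1} (\<lambda>x. (f x + g x) * (f x + g x)) = \<dots>" .
  have "(\<lambda>j. ((legendre_coeff f j + legendre_coeff g j)\<^sup>2 - (legendre_coeff f j)\<^sup>2 - (legendre_coeff g j)\<^sup>2) / 2)
    sums ((integral {0..1} (\<lambda>x. (f x + g x) * (f x + g x))
      - integral {0..1} (\<lambda>x. f x * f x) - integral {0..1} (\<lambda>x. g x * g x)) / 2)"
    using parseval_square[OF cfg] unfolding lc
    by (intro sums_divide sums_diff parseval_square f g)
  moreover have "(\<lambda>j. ((legendre_coeff f j + legendre_coeff g j)\<^sup>2 - (legendre_coeff f j)\<^sup>2 - (legendre_coeff g j)\<^sup>2) / 2)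
    = (\<lambda>j. legendre_coeff f j * legendre_coeff g j)"
    by (rule ext) (simp add: power2_sum)
  ultimately show ?thesis by (simp only: I) simp
qed

text \<open>
  The pairing is bilinear, without complex conjugation, because this is the pairing that occurs in
  a matrix product; the identity splits into four real ones.
\<close>

lemma parseval:
  fixes f g :: "real \<Rightarrow> complex"
  assumes f: "continuous_on {0..1} f" and g: "continuous_on {0..1} g"
  shows "(\<lambda>j. legendre_coeff f j * legendre_coeff g j) sums integral {0..1} (\<lambda>x. f x * g x)"
proof -
  have part: "Re (integral {0..1} h) = integral {0..1} (\<lambda>x. Re (h x))"
      "Im (integral {0..1} h) = integral {0..1} (\<lambda>x. Im (h x))"
    if "continuous_on {0..1} h" for h :: "real \<Rightarrow> complex"
    using integral_linear[OF integrable_continuous_interval[OF that] bounded_linear_Re]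
      integral_linear[OF integrable_continuous_interval[OF that] bounded_linear_Im]
    by (simp_all add: o_def)
  have cf: "continuous_on {0..1} (\<lambda>x. Re (f x))" "continuous_on {0..1} (\<lambda>x. Im (f x))"
    by (intro continuous_intros f)+
  have cg: "continuous_on {0..1} (\<lambda>x. Re (g x))" "continuous_on {0..1} (\<lambda>x. Im (g x))"
    by (intro continuous_intros g)+
  have lc: "Re (legendre_coeff h j) = legendre_coeff (\<lambda>x. Re (h x)) j"
    "Im (legendre_coeff h j) = legendre_coeff (\<lambda>x. Im (h x)) j"
    if "continuous_on {0..1} h" for h :: "real \<Rightarrow> complex" and j
  proof -
    have "continuous_on {0..1} (\<lambda>x. poly (shifted_legendre j) x *\<^sub>R h x)"
      by (intro continuous_intros that)
    from part[OF this] show "Re (legendre_coeff h j) = legendre_coeff (\<lambda>x. Re (h x)) j"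
      "Im (legendre_coeff h j) = legendre_coeff (\<lambda>x. Im (h x)) j"
      by (simp_all add: legendre_coeff_def)
  qed
  have cfg: "continuous_on {0..1} (\<lambda>x. f x * g x)" by (intro continuous_intros f g)
  have int: "(\<lambda>x. u x * v x) integrable_on {0..1}"
    if "continuous_on {0..1} u" "continuous_on {0..1} v" for u v :: "real \<Rightarrow> real"
    by (intro integrable_continuous_interval continuous_intros that)
  show ?thesis
    unfolding sums_complex_iff
  proof
    show "(\<lambda>j. Re (legendre_coeff f j * legendre_coeff g j)) sums Re (integral {0..1} (\<lambda>x. f x * g x))"
      using sums_diff[OF parseval_real[OF cf(1) cg(1)] parseval_real[OF cf(2) cg(2)]]
      by (simp add: lc[OF f] lc[OF g] part[OF cfg] integral_diff int cf cg)
    show "(\<lambda>j. Im (legendre_coeff f j * legendre_coeff g j)) sums Im (integral {0..1} (\<lambda>x. f x * g x))"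
      using sums_add[OF parseval_real[OF cf(1) cg(2)] parseval_real[OF cf(2) cg(1)]]
      by (simp add: lc[OF f] lc[OF g] part[OF cfg] integral_add int cf cg)
  qed
qed


section \<open>Continuous Volterra kernels under the star product\<close>

definition lower_triangle :: "(real \<times> real) set" where
  "lower_triangle = {(t, s). 0 \<le> s \<and> s \<le> t \<and> t \<le> 1}"

text \<open>
  Continuity is required only on the closed triangle: a kernel may jump across the diagonal. The
  condition is weak enough to pass to \<open>\<star>\<close>-products by a short argument, and strong enough for a
  kernel to be determined by its integrals against polynomials.
\<close>

definition volterra :: "kernel \<Rightarrow> bool" where
  "volterra f \<longleftrightarrow> continuous_on lower_triangle (\<lambda>(t, s). f t s) \<and> (\<forall>t s. (t, s) \<notin> lower_triangle \<longrightarrow> f t s = 0)"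

lemma volterra_continuous:
  assumes "volterra f" "continuous_on A a" "continuous_on A b" "\<And>x. x \<in> A \<Longrightarrow> (a x, b x) \<in> lower_triangle"
  shows "continuous_on A (\<lambda>x. f (a x) (b x))"
proof -
  have "continuous_on lower_triangle (\<lambda>(t, s). f t s)" using assms(1) by (simp add: volterra_def)
  from continuous_on_compose2[OF this continuous_on_Pair[OF assms(2,3)]] assms(4)
  show ?thesis by (simp add: image_subset_iff)
qed

lemma compact_triangle: "compact lower_triangle"
proof -
  have "lower_triangle = ({0..1} \<times> {0..1}) \<inter> {p. snd p \<le> fst p}" by (auto simp: lower_triangle_def)
  moreover have "closed {p :: real \<times> real. snd p \<le> fst p}"
    by (intro closed_Collect_le continuous_intros)
  ultimately show ?thesis by (metis compact_Icc compact_Int_closed compact_Times)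
qed

lemma volterra_bounded:
  assumes "volterra f"
  obtains B where "\<And>t s. norm (f t s) \<le> B"
proof -
  have "bounded ((\<lambda>(t, s). f t s) ` lower_triangle)"
    using assms compact_triangle by (intro compact_imp_bounded compact_continuous_image) (auto simp: volterra_def)
  then obtain B where B: "B > 0" "\<And>p. p \<in> lower_triangle \<Longrightarrow> norm (f (fst p) (snd p)) \<le> B"
    unfolding bounded_pos by (auto simp: case_prod_beta)
  have "norm (f t s) \<le> B" for t s
    using B(1) B(2)[of "(t, s)"] assms by (cases "(t, s) \<in> lower_triangle") (auto simp: volterra_def)
  then show ?thesis by (rule that)
qed

lemma volterra_measurable:
  assumes "volterra f" "a \<in> borel_measurable M" "b \<in> borel_measurable M"
  shows "(\<lambda>x. f (a x) (b x)) \<in> borel_measurable M"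
proof -
  have "(\<lambda>p. indicator lower_triangle p *\<^sub>R (case p of (t, s) \<Rightarrow> f t s)) \<in> borel_measurable borel"
    using assms(1) compact_triangle
    by (intro borel_measurable_continuous_on_indicator) (auto simp: volterra_def compact_imp_closed)
  also have "(\<lambda>p. indicator lower_triangle p *\<^sub>R (case p of (t, s) \<Rightarrow> f t s)) = (\<lambda>(t, s). f t s)"
    using assms(1) by (auto simp: volterra_def indicator_def fun_eq_iff)
  finally have "(\<lambda>(t, s). f t s) \<in> borel_measurable borel" .
  from measurable_compose[OF borel_measurable_Pair[OF assms(2,3)] this] show ?thesis by simp
qed

lemma volterra_combination:
  assumes "volterra f" "volterra g"
  shows "volterra (\<lambda>t s. c * f t s + d * g t s)"
  using assms by (auto simp: volterra_def case_prod_beta intro!: continuous_intros)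

lemma volterra_theta_kernel:
  assumes "continuous_on ({0..1} \<times> {0..1}) (\<lambda>(t, s). F t s)"
  shows "volterra (theta_kernel F)"
  unfolding volterra_def
proof (intro conjI allI impI)
  have "continuous_on lower_triangle (\<lambda>(t, s). F t s)"
    by (rule continuous_on_subset[OF assms]) (auto simp: lower_triangle_def)
  then show "continuous_on lower_triangle (\<lambda>(t, s). theta_kernel F t s)"
    by (rule continuous_on_eq) (auto simp: lower_triangle_def theta_kernel_def heaviside_def)
qed (auto simp: lower_triangle_def theta_kernel_def heaviside_def)

lemma integral_affine_unit:
  fixes h :: "real \<Rightarrow> complex"
  assumes "s \<le> t" "continuous_on {s..t} h"
  shows "integral {s..t} h = (t - s) *\<^sub>R integral {0..1} (\<lambda>u. h (s + (t - s) * u))"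
proof (cases "s = t")
  case False
  then have "t - s > 0" using assms by simp
  have "(h has_integral integral {s..t} h) (cbox s t)"
    using integrable_integral[OF integrable_continuous_interval[OF assms(2)]] by simp
  from has_integral_affinity'[OF this \<open>t - s > 0\<close>, of s] \<open>t - s > 0\<close>
  have "((\<lambda>u. h (s + (t - s) * u)) has_integral (integral {s..t} h /\<^sub>R (t - s))) {0..1}"
    by (simp add: add.commute)
  then show ?thesis using \<open>t - s > 0\<close> by (simp add: integral_unique)
qed simp

lemma kstar_eq_integral:
  assumes f: "volterra f" and g: "volterra g" and ts: "(t, s) \<in> lower_triangle"
  shows "kstar f g t s = integral {s..t} (\<lambda>\<tau>. f t \<tau> * g \<tau> s)"
proof -
  have cont: "continuous_on {s..t} (\<lambda>\<tau>. f t \<tau> * g \<tau> s)"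
    using ts by (intro continuous_intros volterra_continuous[OF f] volterra_continuous[OF g])
      (auto simp: lower_triangle_def)
  have "indicator {0..1} \<tau> *\<^sub>R (f t \<tau> * g \<tau> s) = indicator {s..t} \<tau> *\<^sub>R (f t \<tau> * g \<tau> s)" for \<tau>
  proof (cases "\<tau> \<in> {s..t}")
    case False
    then have "(t, \<tau>) \<notin> lower_triangle \<or> (\<tau>, s) \<notin> lower_triangle" by (auto simp: lower_triangle_def)
    then have "f t \<tau> * g \<tau> s = 0" using f g by (auto simp: volterra_def)
    then show ?thesis by simp
  qed (use ts in \<open>auto simp: lower_triangle_def indicator_def\<close>)
  then have "kstar f g t s = (LBINT \<tau>:{s..t}. f t \<tau> * g \<tau> s)"
    by (simp only: kstar_def set_lebesgue_integral_def)
  also have "\<dots> = integral {s..t} (\<lambda>\<tau>. f t \<tau> * g \<tau> s)"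
    by (intro set_borel_integral_eq_integral borel_integrable_atLeastAtMost' cont)
  finally show ?thesis .
qed

lemma kstar_outside_triangle:
  assumes f: "volterra f" and g: "volterra g" and ts: "(t, s) \<notin> lower_triangle"
  shows "kstar f g t s = 0"
proof -
  have "f t \<tau> * g \<tau> s = 0" for \<tau>
  proof -
    have "(t, \<tau>) \<notin> lower_triangle \<or> (\<tau>, s) \<notin> lower_triangle" using ts by (auto simp: lower_triangle_def)
    then show ?thesis using f g by (auto simp: volterra_def)
  qed
  then show ?thesis by (simp only: kstar_def set_lebesgue_integral_def) simp
qed

text \<open>
  Rescaling the interval of integration from \<open>[s, t]\<close> to \<open>[0, 1]\<close> turns the product into an integral
  over a fixed interval whose integrand depends continuously on the parameters \<open>(t, s)\<close>.
\<close>

lemma volterra_kstar: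
  assumes f: "volterra f" and g: "volterra g"
  shows "volterra (kstar f g)"
  unfolding volterra_def
proof (intro conjI allI impI)
  let ?\<tau> = "\<lambda>p u. snd p + (fst p - snd p) * u"
  have in_triangle: "(fst p, ?\<tau> p u) \<in> lower_triangle \<and> (?\<tau> p u, snd p) \<in> lower_triangle"
    if "p \<in> lower_triangle" "u \<in> {0..1}" for p and u :: real
  proof -
    have "(fst p - snd p) * u \<le> (fst p - snd p) * 1"
      using that by (intro mult_left_mono) (auto simp: lower_triangle_def)
    moreover have "0 \<le> (fst p - snd p) * u" using that by (auto simp: lower_triangle_def)
    ultimately show ?thesis using that by (auto simp: lower_triangle_def)
  qed
  have "continuous_on (lower_triangle \<times> cbox 0 1) (\<lambda>(p, u). f (fst p) (?\<tau> p u) * g (?\<tau> p u) (snd p))"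
    unfolding case_prod_beta
    by (intro continuous_intros volterra_continuous[OF f] volterra_continuous[OF g])
       (use in_triangle in auto)
  then have "continuous_on lower_triangle
      (\<lambda>p. (fst p - snd p) *\<^sub>R integral (cbox 0 1) (\<lambda>u. f (fst p) (?\<tau> p u) * g (?\<tau> p u) (snd p)))"
    by (intro continuous_intros integral_continuous_on_param)
  then show "continuous_on lower_triangle (\<lambda>(t, s). kstar f g t s)"
  proof (rule continuous_on_eq)
    fix p assume p: "p \<in> lower_triangle"
    obtain t s where ts: "p = (t, s)" by (cases p)
    have "continuous_on {s..t} (\<lambda>\<tau>. f t \<tau> * g \<tau> s)"
      using p ts by (intro continuous_intros volterra_continuous[OF f] volterra_continuous[OF g])
        (auto simp: lower_triangle_def)
    then show "(fst p - snd p) *\<^sub>R integral (cbox 0 1) (\<lambda>u. f (fst p) (?\<tau> p u) * g (?\<tau> p u) (snd p))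
        = (case p of (t, s) \<Rightarrow> kstar f g t s)"
      using p by (simp add: ts kstar_eq_integral[OF f g] integral_affine_unit lower_triangle_def)
  qed
qed (rule kstar_outside_triangle[OF f g])

text \<open>
  A finite measure makes every bounded measurable integrand integrable, both on the interval and
  on the square.
\<close>

abbreviation unit_measure :: "real measure" where
  "unit_measure \<equiv> restrict_space lborel {0..1}"

lemma set_integral_unit_measure:
  fixes f :: "real \<Rightarrow> complex"
  shows "(LBINT \<tau>:{0..1}. f \<tau>) = (\<integral>\<tau>. f \<tau> \<partial>unit_measure)"
  by (simp add: set_lebesgue_integral_def integral_restrict_space)

interpretation unit_measure: finite_measure unit_measure
  by (rule finite_measureI) (simp add: emeasure_restrict_space space_restrict_space)

interpretation unit_square: pair_sigma_finite unit_measure unit_measure ..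

lemma unit_measurable_id: "(\<lambda>x. x) \<in> borel_measurable unit_measure"
  by (rule measurable_restrict_space1) simp

lemma volterra_integrable:
  assumes f: "volterra f" and g: "volterra g"
  shows "integrable unit_measure (\<lambda>\<tau>. f t \<tau> * g \<tau> s)"
proof -
  obtain A where A: "\<And>t s. norm (f t s) \<le> A" using volterra_bounded[OF f] by blast
  obtain B where B: "\<And>t s. norm (g t s) \<le> B" using volterra_bounded[OF g] by blast
  have "norm (f t \<tau> * g \<tau> s) \<le> A * B" for \<tau>
    unfolding norm_mult by (intro mult_mono A B) (auto intro: order_trans[OF norm_ge_zero A])
  then show ?thesis
    by (intro unit_measure.integrable_const_bound[of _ "A * B"] AE_I2 borel_measurable_times
        volterra_measurable f g unit_measurable_id measurable_const) auto
qed

lemma kstar_combination_left: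
  assumes "volterra f" "volterra g" "volterra h"
  shows "kstar (\<lambda>t s. c * f t s + d * g t s) h = (\<lambda>t s. c * kstar f h t s + d * kstar g h t s)"
proof (intro ext)
  fix t s
  have "kstar (\<lambda>t s. c * f t s + d * g t s) h t s
      = (\<integral>\<tau>. c * (f t \<tau> * h \<tau> s) + d * (g t \<tau> * h \<tau> s) \<partial>unit_measure)"
    by (simp add: kstar_def set_integral_unit_measure algebra_simps)
  also have "\<dots> = c * kstar f h t s + d * kstar g h t s"
    by (simp add: kstar_def set_integral_unit_measure volterra_integrable assms)
  finally show "kstar (\<lambda>t s. c * f t s + d * g t s) h t s = \<dots>" .
qed

lemma kstar_combination_right:
  assumes "volterra f" "volterra g" "volterra h"
  shows "kstar h (\<lambda>t s. c * f t s + d * g t s) = (\<lambda>t s. c * kstar h f t s + d * kstar h g t s)"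
proof (intro ext)
  fix t s
  have "kstar h (\<lambda>t s. c * f t s + d * g t s) t s
      = (\<integral>\<tau>. c * (h t \<tau> * f \<tau> s) + d * (h t \<tau> * g \<tau> s) \<partial>unit_measure)"
    by (simp add: kstar_def set_integral_unit_measure algebra_simps)
  also have "\<dots> = c * kstar h f t s + d * kstar h g t s"
    by (simp add: kstar_def set_integral_unit_measure volterra_integrable assms)
  finally show "kstar h (\<lambda>t s. c * f t s + d * g t s) t s = \<dots>" .
qed

text \<open>
  Both sides are iterated integrals of \<open>f t \<sigma> * g \<sigma> \<tau> * h \<tau> s\<close> over the square; Fubini's theorem
  applies since the kernels are bounded and measurable.
\<close>

lemma kstar_assoc:
  assumes f: "volterra f" and g: "volterra g" and h: "volterra h"
  shows "kstar (kstar f g) h = kstar f (kstar g h)"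
proof (intro ext)
  fix t s
  obtain A where A: "\<And>t s. norm (f t s) \<le> A" using volterra_bounded[OF f] by blast
  obtain B where B: "\<And>t s. norm (g t s) \<le> B" using volterra_bounded[OF g] by blast
  obtain C where C: "\<And>t s. norm (h t s) \<le> C" using volterra_bounded[OF h] by blast
  have "norm (f t \<sigma> * g \<sigma> \<tau> * h \<tau> s) \<le> A * B * C" for \<sigma> \<tau>
    unfolding norm_mult
    by (intro mult_mono A B C mult_nonneg_nonneg)
       (auto intro: order_trans[OF norm_ge_zero A] order_trans[OF norm_ge_zero B])
  moreover have "finite_measure (unit_measure \<Otimes>\<^sub>M unit_measure)"
    by (intro finite_measure_pair_measure unit_measure.finite_measure_axioms)
  ultimately have int: "integrable (unit_measure \<Otimes>\<^sub>M unit_measure) (\<lambda>(\<sigma>, \<tau>). f t \<sigma> * g \<sigma> \<tau> * h \<tau> s)"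
    unfolding case_prod_beta
    by (intro finite_measure.integrable_const_bound[of _ _ "A * B * C"] AE_I2 borel_measurable_times
        volterra_measurable f g h measurable_const measurable_compose[OF measurable_fst unit_measurable_id]
        measurable_compose[OF measurable_snd unit_measurable_id]) auto
  have "kstar (kstar f g) h t s = (\<integral>\<tau>. (\<integral>\<sigma>. f t \<sigma> * g \<sigma> \<tau> * h \<tau> s \<partial>unit_measure) \<partial>unit_measure)"
    by (simp add: kstar_def set_integral_unit_measure)
  also have "\<dots> = (\<integral>\<sigma>. (\<integral>\<tau>. f t \<sigma> * g \<sigma> \<tau> * h \<tau> s \<partial>unit_measure) \<partial>unit_measure)"
    by (rule unit_square.Fubini_integral[OF int])
  also have "\<dots> = kstar f (kstar g h) t s"
    by (simp add: kstar_def set_integral_unit_measure mult.assoc)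
  finally show "kstar (kstar f g) h t s = kstar f (kstar g h) t s" .
qed


section \<open>Coefficient matrices of Volterra kernels\<close>

text \<open>
  The values at \<open>(1, 0)\<close> of \<open>\<star>\<close>-products see every point of the unit square: the Heaviside factors
  \<open>\<Theta>(1 - s)\<close> and \<open>\<Theta>(t - 0)\<close> are \<open>1\<close>. The next two kernels put \<open>p\<^sub>k\<close> to the left and \<open>p\<^sub>l\<close> to the
  right of a kernel \<open>f\<close>, so that its coefficient is \<open>(row\<^sub>k \<star> f \<star> column\<^sub>l)(1, 0)\<close>. Statements
  about coefficients then follow from associativity and bilinearity of \<open>\<star>\<close>.
\<close>

definition row_kernel :: "nat \<Rightarrow> kernel" where
  "row_kernel k = theta_kernel (\<lambda>t s. of_real (poly (shifted_legendre k) s))"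

definition column_kernel :: "nat \<Rightarrow> kernel" where
  "column_kernel l = theta_kernel (\<lambda>t s. of_real (poly (shifted_legendre l) t))"

lemma volterra_row_kernel: "volterra (row_kernel k)"
  unfolding row_kernel_def case_prod_beta
  by (intro volterra_theta_kernel) (auto simp: case_prod_beta intro!: continuous_intros)

lemma volterra_column_kernel: "volterra (column_kernel l)"
  unfolding column_kernel_def case_prod_beta
  by (intro volterra_theta_kernel) (auto simp: case_prod_beta intro!: continuous_intros)

lemma row_kernel_1: "s \<in> {0..1} \<Longrightarrow> row_kernel k 1 s = of_real (poly (shifted_legendre k) s)"
  by (simp add: row_kernel_def theta_kernel_def heaviside_def)

lemma column_kernel_0: "t \<in> {0..1} \<Longrightarrow> column_kernel l t 0 = of_real (poly (shifted_legendre l) t)"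
  by (simp add: column_kernel_def theta_kernel_def heaviside_def)

lemma kernel_coeffs_eq_kstar:
  "kernel_coeffs f k l = kstar (row_kernel k) (kstar f (column_kernel l)) 1 0"
proof -
  have "kernel_coeffs f k l
      = (\<integral>\<tau>. (\<integral>\<rho>. row_kernel k 1 \<tau> * (f \<tau> \<rho> * column_kernel l \<rho> 0) \<partial>unit_measure) \<partial>unit_measure)"
    unfolding kernel_coeffs_def set_integral_unit_measure
    by (intro Bochner_Integration.integral_cong refl)
       (simp add: row_kernel_1 column_kernel_0 space_restrict_space algebra_simps)
  then show ?thesis
    by (simp add: kstar_def set_integral_unit_measure)
qed

lemma kstar_row_kernel:
  assumes "volterra f"
  shows "kstar (row_kernel k) f 1 0 = legendre_coeff (\<lambda>t. f t 0) k"
proof -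
  have "kstar (row_kernel k) f 1 0 = integral {0..1} (\<lambda>\<tau>. row_kernel k 1 \<tau> * f \<tau> 0)"
    by (intro kstar_eq_integral volterra_row_kernel assms) (simp add: lower_triangle_def)
  also have "\<dots> = legendre_coeff (\<lambda>t. f t 0) k"
    unfolding legendre_coeff_def by (intro integral_cong) (simp add: row_kernel_1 scaleR_conv_of_real)
  finally show ?thesis .
qed

lemma kstar_column_kernel:
  assumes "volterra f" "t \<in> {0..1}"
  shows "kstar f (column_kernel l) t 0 = integral {0..t} (\<lambda>x. poly (shifted_legendre l) x *\<^sub>R f t x)"
proof -
  have "kstar f (column_kernel l) t 0 = integral {0..t} (\<lambda>\<tau>. f t \<tau> * column_kernel l \<tau> 0)"
    using assms by (intro kstar_eq_integral volterra_column_kernel) (auto simp: lower_triangle_def)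
  also have "\<dots> = integral {0..t} (\<lambda>x. poly (shifted_legendre l) x *\<^sub>R f t x)"
    using assms(2) by (intro integral_cong) (simp add: column_kernel_0 scaleR_conv_of_real)
  finally show ?thesis .
qed

text \<open>
  Put \<open>\<phi> = row\<^sub>k \<star> f\<close> and \<open>\<psi> = g \<star> column\<^sub>l\<close>. By associativity the \<open>(k, l)\<close> coefficient of
  \<open>f \<star> g\<close> is \<open>(\<phi> \<star> \<psi>)(1, 0)\<close>, the integral of \<open>\<phi>(1, x) \<psi>(x, 0)\<close>, while the entries of the two
  matrices are the Legendre coefficients of these two factors. Both factors are continuous on
  \<open>[0, 1]\<close>, so Parseval's identity sums the series.
\<close>

lemma kernel_coeffs_kstar:
  assumes f: "volterra f" and g: "volterra g"
  shows "(\<lambda>j. kernel_coeffs f k j * kernel_coeffs g j l) sums kernel_coeffs (kstar f g) k l"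
proof -
  define \<phi> where "\<phi> = kstar (row_kernel k) f"
  define \<psi> where "\<psi> = kstar g (column_kernel l)"
  have \<phi>: "volterra \<phi>" and \<psi>: "volterra \<psi>"
    by (auto simp: \<phi>_def \<psi>_def intro!: volterra_kstar volterra_row_kernel volterra_column_kernel f g)
  have F: "kernel_coeffs f k j = legendre_coeff (\<phi> 1) j" for j
  proof -
    have "kernel_coeffs f k j = kstar \<phi> (column_kernel j) 1 0"
      by (simp add: kernel_coeffs_eq_kstar \<phi>_def kstar_assoc volterra_row_kernel volterra_column_kernel f)
    then show ?thesis by (simp add: kstar_column_kernel[OF \<phi>] legendre_coeff_def)
  qed
  have G: "kernel_coeffs g j l = legendre_coeff (\<lambda>t. \<psi> t 0) j" for j
    by (simp add: kernel_coeffs_eq_kstar kstar_row_kernel \<psi> flip: \<psi>_def)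
  have "kernel_coeffs (kstar f g) k l = kstar \<phi> \<psi> 1 0"
    by (simp add: kernel_coeffs_eq_kstar \<phi>_def \<psi>_def kstar_assoc volterra_kstar
        volterra_row_kernel volterra_column_kernel f g)
  also have "\<dots> = integral {0..1} (\<lambda>x. \<phi> 1 x * \<psi> x 0)"
    by (intro kstar_eq_integral \<phi> \<psi>) (simp add: lower_triangle_def)
  finally have "kernel_coeffs (kstar f g) k l = integral {0..1} (\<lambda>x. \<phi> 1 x * \<psi> x 0)" .
  moreover have "continuous_on {0..1} (\<lambda>x. \<phi> 1 x)" "continuous_on {0..1} (\<lambda>x. \<psi> x 0)"
    by (intro volterra_continuous[OF \<phi>] volterra_continuous[OF \<psi>] continuous_intros;
        simp add: lower_triangle_def)+
  ultimately show ?thesis using parseval by (simp add: F G)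
qed

lemma kernel_coeffs_combination:
  assumes "volterra f" "volterra g"
  shows "kernel_coeffs (\<lambda>t s. c * f t s + d * g t s) k l = c * kernel_coeffs f k l + d * kernel_coeffs g k l"
  by (simp add: kernel_coeffs_eq_kstar kstar_combination_left kstar_combination_right assms
      volterra_kstar volterra_row_kernel volterra_column_kernel)

lemma legendre_coeff_shifted_legendre:
  "legendre_coeff (\<lambda>x. \<alpha> * of_real (poly (shifted_legendre l) x)) k = (\<alpha> :: complex) * mat_one k l"
proof -
  have "(poly (shifted_legendre k * shifted_legendre l) has_integral
      poly_integral (shifted_legendre k * shifted_legendre l)) {0..1}"
    unfolding poly_integral_def by (intro integrable_integral poly_integrable)
  then have "((\<lambda>x. poly (shifted_legendre k * shifted_legendre l) x *\<^sub>R \<alpha>) has_integral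
      poly_integral (shifted_legendre k * shifted_legendre l) *\<^sub>R \<alpha>) {0..1}"
    by (rule has_integral_scaleR_left)
  then show ?thesis
    unfolding legendre_coeff_def mat_one_def shifted_legendre_orthonormal
    by (intro integral_unique) (auto simp: scaleR_conv_of_real algebra_simps)
qed

text \<open>
  Vanishing of all coefficients says that \<open>\<integral> f(t, x) p\<^sub>l(x) dx + \<alpha> p\<^sub>l(t)\<close> is orthogonal to every
  \<open>p\<^sub>k\<close>; being continuous in \<open>t\<close>, it vanishes. The integral runs over \<open>[0, t]\<close>, so \<open>t = 0\<close> gives
  \<open>\<alpha> = 0\<close>: a Volterra integral operator cannot imitate a multiple of the identity. What remains
  says that \<open>f(t, x)\<close> is orthogonal to all polynomials on \<open>[0, t]\<close>.
\<close>

lemma coeff_matrix_eq_0: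
  assumes f: "volterra f" and zero: "\<And>k l. \<alpha> * mat_one k l + kernel_coeffs f k l = 0"
  shows "\<alpha> = 0" "f t s = 0"
proof -
  define \<psi> where "\<psi> = (\<lambda>l t. kstar f (column_kernel l) t 0)"
  have cont: "continuous_on {0..1} (\<psi> l)" for l
    unfolding \<psi>_def
    by (intro volterra_continuous[OF volterra_kstar[OF f volterra_column_kernel]] continuous_intros)
       (simp add: lower_triangle_def)
  have eq0: "\<psi> l t + \<alpha> * of_real (poly (shifted_legendre l) t) = 0" if "t \<in> {0..1}" for l t
  proof (rule legendre_complete[OF _ _ _ that])
    show "continuous_on {0..1} (\<lambda>t. \<psi> l t + \<alpha> * of_real (poly (shifted_legendre l) t))"
      by (intro continuous_intros cont)
    fix k
    have "legendre_coeff (\<lambda>t. \<psi> l t + \<alpha> * of_real (poly (shifted_legendre l) t)) k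
        = legendre_coeff (\<psi> l) k + legendre_coeff (\<lambda>t. \<alpha> * of_real (poly (shifted_legendre l) t)) k"
      by (intro legendre_coeff_add continuous_intros cont)
    also have "legendre_coeff (\<psi> l) k = kernel_coeffs f k l"
      by (simp add: kernel_coeffs_eq_kstar \<psi>_def kstar_row_kernel volterra_kstar[OF f volterra_column_kernel])
    finally show "integral {0..1} (\<lambda>x. poly (shifted_legendre k) x *\<^sub>R
        (\<psi> l x + \<alpha> * of_real (poly (shifted_legendre l) x))) = 0"
      using zero[of k l] by (simp add: legendre_coeff_shifted_legendre legendre_coeff_def add.commute)
  qed simp
  have "\<psi> 0 0 = 0"
    using kstar_column_kernel[OF f, of 0 0] by (simp add: \<psi>_def)
  with eq0[of 0 0] show "\<alpha> = 0" by (simp add: shifted_legendre_0)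
  have inner: "f t s = 0" if "0 < t" "t \<le> 1" "s \<in> {0..t}" for t s
  proof (rule legendre_complete[OF _ _ _ that(3)])
    show "continuous_on {0..t} (f t)"
      using that by (intro volterra_continuous[OF f] continuous_intros) (auto simp: lower_triangle_def)
    show "integral {0..t} (\<lambda>x. poly (shifted_legendre l) x *\<^sub>R f t x) = 0" for l
      using eq0[of t l] \<open>\<alpha> = 0\<close> that kstar_column_kernel[OF f, of t l] by (simp add: \<psi>_def)
  qed (use that in auto)
  \<comment> \<open>The interval \<open>[0, t]\<close> degenerates at \<open>t = 0\<close>; there continuity along the edge \<open>s = 0\<close> is used.\<close>
  have corner: "f 0 0 = 0"
  proof (rule continuous_constant_on_closure[of "{0<..1}" "\<lambda>t. f t 0"])
    show "continuous_on (closure {0<..1}) (\<lambda>t. f t 0)"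
      by (intro volterra_continuous[OF f] continuous_intros) (auto simp: lower_triangle_def)
  qed (auto intro: inner)
  show "f t s = 0"
  proof (cases "(t, s) \<in> lower_triangle")
    case True
    then show ?thesis using inner[of t s] corner by (cases "t = 0") (auto simp: lower_triangle_def)
  next
    case False
    then show ?thesis using f by (simp add: volterra_def)
  qed
qed


section \<open>Sums of star products of kernels depending on the first variable\<close>

text \<open>
  On the edge \<open>s = 0\<close> the double series at \<open>(t0, 0)\<close> reduces to the terms with \<open>j = 0\<close>, an ordinary
  power series in \<open>t - t0\<close>. The edge suffices for a kernel depending on \<open>t\<close> alone, since
  \<open>\<Theta>(t - 0) = 1\<close> there.
\<close>

lemma analytic_on_square_continuous:
  assumes "analytic_on_square F"
  shows "continuous_on {0..1} (\<lambda>t. F t 0)"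
  unfolding continuous_on_eq_continuous_within
proof
  fix t0 :: real assume t0: "t0 \<in> {0..1}"
  have "(0::real) \<in> {0..1}" by simp
  from bspec[OF bspec[OF assms[unfolded analytic_on_square_def] t0] this]
  obtain a r where "r > 0" and exp:
    "\<forall>t\<in>{0..1}. \<forall>s\<in>{0..1}. \<bar>t - t0\<bar> < r \<longrightarrow> \<bar>s - 0\<bar> < r \<longrightarrow>
        ((\<lambda>(i, j). a i j * of_real ((t - t0) ^ i * (s - 0) ^ j)) has_sum F t s) UNIV"
    by (elim exE conjE)
  have sums: "(\<lambda>i. a i 0 * of_real (t - t0) ^ i) sums F t 0" if "t \<in> {0..1}" "\<bar>t - t0\<bar> < r" for t
  proof -
    have "((\<lambda>(i, j). a i j * of_real ((t - t0) ^ i * 0 ^ j)) has_sum F t 0) UNIV"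
      using bspec[OF bspec[OF exp, of t], of 0] that \<open>r > 0\<close> by simp
    also have "?this \<longleftrightarrow> ((\<lambda>(i, j). a i j * of_real ((t - t0) ^ i * 0 ^ j)) has_sum F t 0) ((\<lambda>i. (i, 0)) ` UNIV)"
      by (rule has_sum_cong_neutral) (auto simp: image_iff)
    also have "\<dots> \<longleftrightarrow> ((\<lambda>i. a i 0 * of_real (t - t0) ^ i) has_sum F t 0) UNIV"
      by (subst has_sum_reindex) (auto simp: inj_on_def o_def)
    finally show ?thesis by (rule has_sum_imp_sums)
  qed
  \<comment> \<open>The series is known to converge only inside \<open>[0, 1]\<close>; one such point \<open>t1\<close> on either side of \<open>t0\<close> bounds the radius of convergence from below.\<close>
  define d where "d = min r (1 / 2) / 2"
  have d: "d > 0" "d < r" "d \<le> 1 / 4" using \<open>r > 0\<close> by (auto simp: d_def)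
  obtain t1 where t1: "t1 \<in> {0..1}" "\<bar>t1 - t0\<bar> = d"
  proof (cases "t0 \<le> 1 / 2")
    case True
    then show ?thesis using that[of "t0 + d"] d t0 by auto
  next
    case False
    then show ?thesis using that[of "t0 - d"] d t0 by auto
  qed
  have "summable (\<lambda>i. a i 0 * of_real (t1 - t0) ^ i)"
    using sums[OF t1(1)] t1(2) d by (simp add: sums_summable)
  then have "isCont (\<lambda>z. \<Sum>i. a i 0 * z ^ i) (of_real (t0 - t0))"
    by (rule isCont_powser) (use t1 d in simp)
  then have "isCont (\<lambda>t. \<Sum>i. a i 0 * of_real (t - t0) ^ i) t0"
    by (rule isCont_o2[rotated]) (intro continuous_intros)
  then have "continuous (at t0 within {0..1}) (\<lambda>t. \<Sum>i. a i 0 * of_real (t - t0) ^ i)"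
    by (rule continuous_at_imp_continuous_at_within)
  then show "continuous (at t0 within {0..1}) (\<lambda>t. F t 0)"
    by (rule continuous_transform_within[OF _ \<open>r > 0\<close> t0])
       (use sums in \<open>auto simp: dist_real_def sums_iff\<close>)
qed

lemma A_Theta_t_volterra:
  assumes "f \<in> A_Theta_t"
  shows "volterra f"
proof -
  obtain F h where F: "analytic_on_square F" "f = theta_kernel F" and h: "f = theta_kernel (\<lambda>t s. h t)"
    using assms by (auto simp: A_Theta_t_def A_Theta_def)
  have "F t 0 = h t" if "t \<in> {0..1}" for t
  proof -
    have "theta_kernel F t 0 = theta_kernel (\<lambda>t s. h t) t 0" using F(2) h by simp
    then show ?thesis using that by (simp add: theta_kernel_def heaviside_def)
  qed
  then have "continuous_on {0..1} h"
    using analytic_on_square_continuous[OF F(1)] by (auto intro: continuous_on_eq)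
  then have "continuous_on ({0..1} \<times> {0..1}) (\<lambda>p. h (fst p))"
    by (rule continuous_on_compose2) (auto intro!: continuous_intros)
  then show ?thesis
    unfolding h by (intro volterra_theta_kernel) (simp add: case_prod_beta)
qed

lemma A_Theta_t_scale:
  assumes "f \<in> A_Theta_t"
  shows "(\<lambda>t s. c * f t s) \<in> A_Theta_t"
proof -
  obtain F h where F: "analytic_on_square F" "f = theta_kernel F" and h: "f = theta_kernel (\<lambda>t s. h t)"
    using assms by (auto simp: A_Theta_t_def A_Theta_def)
  have 1: "analytic_on_square (\<lambda>t s. c * F t s)"
    unfolding analytic_on_square_def
  proof (intro ballI)
    fix t0 s0 :: real assume "t0 \<in> {0..1}" "s0 \<in> {0..1}"
    with F(1) obtain a r where "r > 0" and exp:
      "\<forall>t\<in>{0..1}. \<forall>s\<in>{0..1}. \<bar>t - t0\<bar> < r \<longrightarrow> \<bar>s - s0\<bar> < r \<longrightarrow>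
        ((\<lambda>(i, j). a i j * of_real ((t - t0) ^ i * (s - s0) ^ j)) has_sum F t s) UNIV"
      unfolding analytic_on_square_def by blast
    have "((\<lambda>(i, j). c * a i j * of_real ((t - t0) ^ i * (s - s0) ^ j)) has_sum c * F t s) UNIV"
      if "t \<in> {0..1}" "s \<in> {0..1}" "\<bar>t - t0\<bar> < r" "\<bar>s - s0\<bar> < r" for t s
    proof -
      have "((\<lambda>(i, j). a i j * of_real ((t - t0) ^ i * (s - s0) ^ j)) has_sum F t s) UNIV"
        using exp that by blast
      from has_sum_cmult_right[OF this, of c] show ?thesis
        by (simp add: case_prod_unfold mult.assoc)
    qed
    with \<open>r > 0\<close> show "\<exists>(a :: nat \<Rightarrow> nat \<Rightarrow> complex) r. r > 0 \<and>
      (\<forall>t\<in>{0..1}. \<forall>s\<in>{0..1}. \<bar>t - t0\<bar> < r \<longrightarrow> \<bar>s - s0\<bar> < r \<longrightarrow>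
        ((\<lambda>(i, j). a i j * of_real ((t - t0) ^ i * (s - s0) ^ j)) has_sum c * F t s) UNIV)"
      by (intro exI[of _ "\<lambda>i j. c * a i j"] exI[of _ r]) blast
  qed
  have 2: "(\<lambda>t s. c * f t s) = theta_kernel (\<lambda>t s. c * F t s)"
    unfolding F(2) by (simp add: theta_kernel_def fun_eq_iff)
  have 3: "(\<lambda>t s. c * f t s) = theta_kernel (\<lambda>t s. c * h t)"
    unfolding h by (simp add: theta_kernel_def fun_eq_iff)
  show ?thesis
    unfolding A_Theta_t_def A_Theta_def mem_Collect_eq
    by (rule conjI, rule exI, rule conjI[OF 2 1], rule exI, rule 3)
qed

definition D0t_kernels :: "kernel set" where
  "D0t_kernels = {\<lambda>t s. \<Sum>i<n. kstar_list (gs i) t s | (n :: nat) gs.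
     \<forall>i<n. gs i \<noteq> [] \<and> set (gs i) \<subseteq> A_Theta_t}"

lemma D0t_eq: "D0t = UNIV \<times> D0t_kernels"
  unfolding D0t_def D0t_kernels_def by auto

lemma kstar_list_Cons: "xs \<noteq> [] \<Longrightarrow> kstar_list (x # xs) = kstar x (kstar_list xs)"
  by (cases xs) auto

lemma volterra_kstar_list:
  assumes "xs \<noteq> []" "set xs \<subseteq> A_Theta_t"
  shows "volterra (kstar_list xs)"
  using assms
  by (induction xs rule: list_nonempty_induct)
     (simp_all add: kstar_list_Cons volterra_kstar A_Theta_t_volterra)

lemma kstar_list_append:
  assumes "xs \<noteq> []" "set xs \<subseteq> A_Theta_t" "ys \<noteq> []" "set ys \<subseteq> A_Theta_t"
  shows "kstar_list (xs @ ys) = kstar (kstar_list xs) (kstar_list ys)"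
  using assms(1,2)
proof (induction xs rule: list_nonempty_induct)
  case (single x)
  then show ?case using assms(3) by (simp add: kstar_list_Cons)
next
  case (cons x xs)
  then show ?case
    using assms(3,4) by (simp add: kstar_list_Cons kstar_assoc A_Theta_t_volterra volterra_kstar_list)
qed

text \<open>
  The scalar is absorbed by the first factor, so the definition of \<open>D0t\<close> yields a complex vector space
  even though its sums carry no scalar weights.
\<close>

lemma kstar_list_scale:
  assumes "xs \<noteq> []" "set xs \<subseteq> A_Theta_t"
  shows "\<exists>ys. ys \<noteq> [] \<and> set ys \<subseteq> A_Theta_t \<and> kstar_list ys = (\<lambda>t s. c * kstar_list xs t s)"
proof -
  obtain x zs where xs: "xs = x # zs" using assms(1) by (cases xs) auto
  have "kstar_list ((\<lambda>t s. c * x t s) # zs) = (\<lambda>t s. c * kstar_list xs t s)"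
    by (cases "zs = []") (simp_all add: xs kstar_list_Cons kstar_def mult.assoc)
  then show ?thesis
    using assms xs A_Theta_t_scale[of x c] by (intro exI[of _ "(\<lambda>t s. c * x t s) # zs"]) auto
qed

lemma D0t_kernels_zero: "(\<lambda>t s. 0) \<in> D0t_kernels"
  unfolding D0t_kernels_def by (auto intro!: exI[of _ "0::nat"])

lemma D0t_kernels_kstar_list:
  assumes "xs \<noteq> []" "set xs \<subseteq> A_Theta_t"
  shows "kstar_list xs \<in> D0t_kernels"
  unfolding D0t_kernels_def using assms
  by (intro CollectI exI[of _ "1::nat"] exI[of _ "\<lambda>_. xs"]) auto

lemma D0t_kernels_add:
  assumes "f \<in> D0t_kernels" "g \<in> D0t_kernels"
  shows "(\<lambda>t s. f t s + g t s) \<in> D0t_kernels"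
proof -
  from assms obtain m n :: nat and xs ys where
    f: "f = (\<lambda>t s. \<Sum>i<m. kstar_list (xs i) t s)" "\<forall>i<m. xs i \<noteq> [] \<and> set (xs i) \<subseteq> A_Theta_t" and
    g: "g = (\<lambda>t s. \<Sum>i<n. kstar_list (ys i) t s)" "\<forall>i<n. ys i \<noteq> [] \<and> set (ys i) \<subseteq> A_Theta_t"
    unfolding D0t_kernels_def mem_Collect_eq by metis
  define zs where "zs i = (if i < m then xs i else ys (i - m))" for i :: nat
  have "(\<Sum>i<m + n. kstar_list (zs i) t s)
      = (\<Sum>i<m. kstar_list (zs i) t s) + (\<Sum>i<n. kstar_list (zs (m + i)) t s)" for t s
    by (induction n) (simp_all add: add.assoc)
  then have "(\<Sum>i<m + n. kstar_list (zs i) t s) = f t s + g t s" for t s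
    by (simp add: zs_def f g)
  moreover have "\<forall>i<m + n. zs i \<noteq> [] \<and> set (zs i) \<subseteq> A_Theta_t"
    using f(2) g(2) by (simp add: zs_def)
  ultimately show ?thesis
    unfolding D0t_kernels_def mem_Collect_eq by (intro exI[of _ "m + n"] exI[of _ zs]) (simp add: fun_eq_iff)
qed

lemma D0t_kernels_induct [consumes 1, case_names zero add]:
  assumes "f \<in> D0t_kernels"
    and "P (\<lambda>t s. 0)"
    and step: "\<And>f xs. f \<in> D0t_kernels \<Longrightarrow> P f \<Longrightarrow> xs \<noteq> [] \<Longrightarrow> set xs \<subseteq> A_Theta_t \<Longrightarrow>
      P (\<lambda>t s. f t s + kstar_list xs t s)"
  shows "P f"
proof -
  obtain n :: nat and gs where f: "f = (\<lambda>t s. \<Sum>i<n. kstar_list (gs i) t s)"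
    and gs: "\<forall>i<n. gs i \<noteq> [] \<and> set (gs i) \<subseteq> A_Theta_t"
    using assms(1) unfolding D0t_kernels_def mem_Collect_eq by metis
  have "m \<le> n \<Longrightarrow> P (\<lambda>t s. \<Sum>i<m. kstar_list (gs i) t s)" for m
  proof (induction m)
    case (Suc m)
    have "(\<lambda>t s. \<Sum>i<m. kstar_list (gs i) t s) \<in> D0t_kernels"
      unfolding D0t_kernels_def mem_Collect_eq
      by (rule exI[of _ m], rule exI[of _ gs]) (use gs Suc.prems in auto)
    from step[OF this Suc.IH, of "gs m"] Suc.prems gs show ?case by simp
  qed (use assms(2) in simp)
  then show ?thesis using f by simp
qed

lemma D0t_kernels_volterra: "f \<in> D0t_kernels \<Longrightarrow> volterra f"
proof (induction rule: D0t_kernels_induct)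
  case zero
  show ?case by (simp add: volterra_def case_prod_beta)
next
  case (add f xs)
  then show ?case
    using volterra_combination[of f "kstar_list xs" 1 1] volterra_kstar_list by simp
qed

lemma D0t_kernels_scale: "f \<in> D0t_kernels \<Longrightarrow> (\<lambda>t s. c * f t s) \<in> D0t_kernels"
proof (induction rule: D0t_kernels_induct)
  case (add f xs)
  obtain ys where "ys \<noteq> []" "set ys \<subseteq> A_Theta_t" "kstar_list ys = (\<lambda>t s. c * kstar_list xs t s)"
    using kstar_list_scale add by metis
  then show ?case
    using D0t_kernels_add[OF add.IH D0t_kernels_kstar_list[of ys]] by (simp add: distrib_left)
qed (simp add: D0t_kernels_zero)

lemma D0t_kernels_kstar_kstar_list:
  assumes "f \<in> D0t_kernels" and ys: "ys \<noteq> []" "set ys \<subseteq> A_Theta_t"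
  shows "kstar f (kstar_list ys) \<in> D0t_kernels"
  using assms(1)
proof (induction rule: D0t_kernels_induct)
  case zero
  then show ?case by (simp add: kstar_def D0t_kernels_zero)
next
  case (add f xs)
  have "kstar (\<lambda>t s. f t s + kstar_list xs t s) (kstar_list ys)
      = (\<lambda>t s. kstar f (kstar_list ys) t s + kstar_list (xs @ ys) t s)"
    using kstar_combination_left[of f "kstar_list xs" "kstar_list ys" 1 1] add ys
    by (simp add: D0t_kernels_volterra volterra_kstar_list kstar_list_append)
  then show ?case
    using D0t_kernels_add[OF add.IH D0t_kernels_kstar_list[of "xs @ ys"]] add ys by simp
qed

lemma D0t_kernels_kstar:
  assumes f: "f \<in> D0t_kernels" and g: "g \<in> D0t_kernels"
  shows "kstar f g \<in> D0t_kernels"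
  using g
proof (induction rule: D0t_kernels_induct)
  case zero
  then show ?case by (simp add: kstar_def D0t_kernels_zero)
next
  case (add g ys)
  have "kstar f (\<lambda>t s. g t s + kstar_list ys t s)
      = (\<lambda>t s. kstar f g t s + kstar f (kstar_list ys) t s)"
    using kstar_combination_right[of g "kstar_list ys" f 1 1] add f
    by (simp add: D0t_kernels_volterra volterra_kstar_list)
  then show ?case
    using D0t_kernels_add[OF add.IH D0t_kernels_kstar_kstar_list[OF f]] add by simp
qed


section \<open>The ring of generalised kernels and the algebra of matrices\<close>

lemma D0t_volterra: "(\<alpha>, f) \<in> D0t \<Longrightarrow> volterra f"
  by (auto simp: D0t_eq D0t_kernels_volterra)

lemma gadd_closed: "x \<in> D0t \<Longrightarrow> y \<in> D0t \<Longrightarrow> gadd x y \<in> D0t"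
  by (auto simp: D0t_eq gadd_def D0t_kernels_add)

lemma gstar_closed: "x \<in> D0t \<Longrightarrow> y \<in> D0t \<Longrightarrow> gstar x y \<in> D0t"
  by (auto simp: D0t_eq gstar_def intro!: D0t_kernels_add D0t_kernels_scale D0t_kernels_kstar)

definition gscale :: "complex \<Rightarrow> gkernel \<Rightarrow> gkernel" where
  "gscale c = (\<lambda>(\<alpha>, f). (c * \<alpha>, \<lambda>t s. c * f t s))"

lemma gscale_closed: "x \<in> D0t \<Longrightarrow> gscale c x \<in> D0t"
  by (auto simp: D0t_eq gscale_def D0t_kernels_scale)

lemma gone_closed: "gone \<in> D0t" and gzero_closed: "gzero \<in> D0t"
  by (auto simp: D0t_eq gone_def gzero_def D0t_kernels_zero)

lemma kstar_zero_left: "kstar (\<lambda>t s. 0) f = (\<lambda>t s. 0)"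
  and kstar_zero_right: "kstar f (\<lambda>t s. 0) = (\<lambda>t s. 0)"
  by (simp_all add: kstar_def set_lebesgue_integral_def)

lemma gstar_assoc:
  assumes "x \<in> D0t" "y \<in> D0t" "z \<in> D0t"
  shows "gstar (gstar x y) z = gstar x (gstar y z)"
proof -
  obtain \<alpha> f \<beta> g \<gamma> h where xyz: "x = (\<alpha>, f)" "y = (\<beta>, g)" "z = (\<gamma>, h)"
    by (cases x, cases y, cases z)
  then have f: "volterra f" and g: "volterra g" and h: "volterra h"
    using assms by (auto intro: D0t_volterra)
  have left: "kstar (\<lambda>t s. \<alpha> * g t s + \<beta> * f t s + kstar f g t s) h
      = (\<lambda>t s. \<alpha> * kstar g h t s + \<beta> * kstar f h t s + kstar (kstar f g) h t s)"
    using kstar_combination_left[OF volterra_combination[OF g f, of \<alpha> \<beta>] volterra_kstar[OF f g] h, of 1 1]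
    by (simp add: kstar_combination_left f g h)
  have right: "kstar f (\<lambda>t s. \<beta> * h t s + \<gamma> * g t s + kstar g h t s)
      = (\<lambda>t s. \<beta> * kstar f h t s + \<gamma> * kstar f g t s + kstar f (kstar g h) t s)"
    using kstar_combination_right[OF volterra_combination[OF h g, of \<beta> \<gamma>] volterra_kstar[OF g h] f, of 1 1]
    by (simp add: kstar_combination_right f g h)
  show ?thesis
    by (simp only: xyz gstar_def prod.case left right kstar_assoc[OF f g h])
       (simp add: algebra_simps)
qed

lemma gstar_gadd_left:
  assumes "x \<in> D0t" "y \<in> D0t" "z \<in> D0t"
  shows "gstar (gadd x y) z = gadd (gstar x z) (gstar y z)"
proof -
  obtain \<alpha> f \<beta> g \<gamma> h where xyz: "x = (\<alpha>, f)" "y = (\<beta>, g)" "z = (\<gamma>, h)"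
    by (cases x, cases y, cases z)
  then have "volterra f" "volterra g" "volterra h"
    using assms by (auto intro: D0t_volterra)
  from kstar_combination_left[OF this, of 1 1] show ?thesis
    by (simp add: xyz gstar_def gadd_def algebra_simps)
qed

lemma gstar_gadd_right:
  assumes "x \<in> D0t" "y \<in> D0t" "z \<in> D0t"
  shows "gstar z (gadd x y) = gadd (gstar z x) (gstar z y)"
proof -
  obtain \<alpha> f \<beta> g \<gamma> h where xyz: "x = (\<alpha>, f)" "y = (\<beta>, g)" "z = (\<gamma>, h)"
    by (cases x, cases y, cases z)
  then have "volterra f" "volterra g" "volterra h"
    using assms by (auto intro: D0t_volterra)
  from kstar_combination_right[OF this, of 1 1] show ?thesis
    by (simp add: xyz gstar_def gadd_def algebra_simps)
qed

lemma gadd_assoc: "gadd (gadd x y) z = gadd x (gadd y z)"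
  and gadd_commute: "gadd x y = gadd y x"
  and gadd_gzero: "gadd gzero x = x"
  by (cases x, cases y, cases z, simp add: gadd_def gzero_def algebra_simps)+

lemma gstar_gone_left: "gstar gone x = x"
  and gstar_gone_right: "gstar x gone = x"
  by (cases x, simp add: gstar_def gone_def kstar_zero_left kstar_zero_right)+

lemma ring_D0t: "Ring.ring D0t_ring"
proof (rule ringI)
  show "abelian_group D0t_ring"
  proof (rule abelian_groupI)
    fix x assume "x \<in> carrier D0t_ring"
    then have "gscale (- 1) x \<in> carrier D0t_ring"
      by (simp add: D0t_ring_def gscale_closed)
    moreover have "gscale (- 1) x \<oplus>\<^bsub>D0t_ring\<^esub> x = \<zero>\<^bsub>D0t_ring\<^esub>"
      by (cases x) (simp add: D0t_ring_def gscale_def gadd_def gzero_def)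
    ultimately show "\<exists>y\<in>carrier D0t_ring. y \<oplus>\<^bsub>D0t_ring\<^esub> x = \<zero>\<^bsub>D0t_ring\<^esub>" ..
  qed (simp_all add: D0t_ring_def gadd_closed gzero_closed gadd_assoc gadd_gzero, rule gadd_commute)
  show "Group.monoid D0t_ring"
    by (rule Group.monoidI)
       (simp_all add: D0t_ring_def gstar_closed gone_closed gstar_assoc gstar_gone_left gstar_gone_right)
qed (simp_all add: D0t_ring_def gstar_gadd_left gstar_gadd_right)

lemma coeff_matrix_gadd:
  assumes "x \<in> D0t" "y \<in> D0t"
  shows "coeff_matrix (gadd x y) = (\<lambda>k l. coeff_matrix x k l + coeff_matrix y k l)"
proof -
  obtain \<alpha> f \<beta> g where xy: "x = (\<alpha>, f)" "y = (\<beta>, g)" by (cases x, cases y)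
  then have "volterra f" "volterra g" using assms by (auto intro: D0t_volterra)
  from kernel_coeffs_combination[OF this, of 1 1] show ?thesis
    by (simp add: xy gadd_def coeff_matrix_def fun_eq_iff algebra_simps)
qed

lemma coeff_matrix_gscale: "coeff_matrix (gscale c x) = (\<lambda>k l. c * coeff_matrix x k l)"
  by (cases x) (simp add: gscale_def coeff_matrix_def kernel_coeffs_def fun_eq_iff algebra_simps)

lemma coeff_matrix_gone: "coeff_matrix gone = mat_one"
  by (simp add: gone_def coeff_matrix_def kernel_coeffs_def set_lebesgue_integral_def fun_eq_iff)

lemma coeff_matrix_gzero: "coeff_matrix gzero = (\<lambda>k l. 0)"
  by (simp add: gzero_def coeff_matrix_def kernel_coeffs_def set_lebesgue_integral_def fun_eq_iff)

lemma sums_mat_one: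
  fixes F :: "nat \<Rightarrow> complex"
  shows "(\<lambda>j. mat_one k j * F j) sums F k" "(\<lambda>j. F j * mat_one j k) sums F k"
  using sums_single[of k F] by (simp_all add: mat_one_def if_distrib if_distribR eq_commute cong: if_cong)

text \<open>
  The product \<open>(\<alpha> I + F) (\<beta> I + G)\<close> is expanded into three series in which the identity matrix
  leaves a single term, and the series for \<open>F G\<close>.
\<close>

lemma coeff_matrix_gstar:
  assumes "x \<in> D0t" "y \<in> D0t"
  shows "(\<lambda>j. coeff_matrix x k j * coeff_matrix y j l) sums coeff_matrix (gstar x y) k l"
proof -
  obtain \<alpha> f \<beta> g where xy: "x = (\<alpha>, f)" "y = (\<beta>, g)" by (cases x, cases y)
  then have f: "volterra f" and g: "volterra g" using assms by (auto intro: D0t_volterra)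
  let ?F = "kernel_coeffs f" and ?G = "kernel_coeffs g"
  have "(\<lambda>j. \<alpha> * (mat_one k j * (\<beta> * mat_one j l + ?G j l)) + (\<beta> * (?F k j * mat_one j l) + ?F k j * ?G j l))
      sums (\<alpha> * (\<beta> * mat_one k l + ?G k l) + (\<beta> * ?F k l + kernel_coeffs (kstar f g) k l))"
    by (intro sums_add sums_mult kernel_coeffs_kstar f g sums_mat_one(2)
        sums_mat_one(1)[of k "\<lambda>j. \<beta> * mat_one j l + ?G j l"])
  moreover have "kernel_coeffs (\<lambda>t s. \<alpha> * g t s + \<beta> * f t s + kstar f g t s) k l
      = \<alpha> * ?G k l + \<beta> * ?F k l + kernel_coeffs (kstar f g) k l"
    using kernel_coeffs_combination[OF volterra_combination[OF g f, of \<alpha> \<beta>] volterra_kstar[OF f g], of 1 1 k l]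
    by (simp add: kernel_coeffs_combination f g)
  ultimately show ?thesis
    by (simp add: xy gstar_def coeff_matrix_def algebra_simps)
qed

lemma mat_mult_coeff_matrix:
  assumes "x \<in> D0t" "y \<in> D0t"
  shows "mat_mult (coeff_matrix x) (coeff_matrix y) = coeff_matrix (gstar x y)"
  using coeff_matrix_gstar[OF assms] by (simp add: mat_mult_def sums_iff fun_eq_iff)

lemma inj_on_coeff_matrix: "inj_on coeff_matrix D0t"
proof (rule inj_onI)
  fix x y assume x: "x \<in> D0t" and y: "y \<in> D0t" and eq: "coeff_matrix x = coeff_matrix y"
  obtain \<alpha> f \<beta> g where xy: "x = (\<alpha>, f)" "y = (\<beta>, g)" by (cases x, cases y)
  then have f: "volterra f" and g: "volterra g" using x y by (auto intro: D0t_volterra)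
  have volterra: "volterra (\<lambda>t s. 1 * f t s + (- 1) * g t s)" by (intro volterra_combination f g)
  have zero: "(\<alpha> - \<beta>) * mat_one k l + kernel_coeffs (\<lambda>t s. 1 * f t s + (- 1) * g t s) k l = 0" for k l
    using fun_cong[OF fun_cong[OF eq], of k l]
    by (simp only: kernel_coeffs_combination[OF f g]) (simp add: xy coeff_matrix_def algebra_simps)
  from coeff_matrix_eq_0[OF volterra zero] show "x = y" by (simp add: xy fun_eq_iff)
qed

lemma coeff_matrix_ring_iso: "coeff_matrix \<in> ring_iso D0t_ring coeff_matrix_algebra"
  unfolding ring_iso_def
proof (intro CollectI conjI)
  show "coeff_matrix \<in> ring_hom D0t_ring coeff_matrix_algebra"
    by (rule ring_hom_memI)
       (simp_all add: D0t_ring_def coeff_matrix_algebra_def coeff_matrices_def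
          mat_mult_coeff_matrix coeff_matrix_gadd coeff_matrix_gone)
  show "bij_betw coeff_matrix (carrier D0t_ring) (carrier coeff_matrix_algebra)"
    using inj_on_coeff_matrix
    by (simp add: bij_betw_def D0t_ring_def coeff_matrix_algebra_def coeff_matrices_def)
qed

text \<open>
  The ring axioms for the matrices are transported from the kernels along the bijection. Thus
  associativity of the infinite matrix product rests on associativity of \<open>\<star>\<close> rather than on an
  interchange of summations.
\<close>

lemma ring_coeff_matrix_algebra: "Ring.ring coeff_matrix_algebra"
proof -
  have "coeff_matrix_algebra\<lparr>zero := coeff_matrix \<zero>\<^bsub>D0t_ring\<^esub>\<rparr> = coeff_matrix_algebra"
    by (simp add: D0t_ring_def coeff_matrix_gzero coeff_matrix_algebra_def)
  with ring.ring_iso_imp_img_ring[OF ring_D0t coeff_matrix_ring_iso] show ?thesis by simp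
qed

lemma coeff_matrices_scale:
  assumes "F \<in> coeff_matrices"
  shows "(\<lambda>k l. c * F k l) \<in> coeff_matrices"
proof -
  obtain x where "x \<in> D0t" "F = coeff_matrix x" using assms by (auto simp: coeff_matrices_def)
  then have "(\<lambda>k l. c * F k l) = coeff_matrix (gscale c x)" "gscale c x \<in> D0t"
    by (simp_all add: coeff_matrix_gscale gscale_closed)
  then show ?thesis by (simp add: coeff_matrices_def)
qed

lemma coeff_matrices_summable:
  assumes "F \<in> coeff_matrices" "G \<in> coeff_matrices"
  shows "summable (\<lambda>j. F k j * G j l)"
proof -
  obtain x y where "x \<in> D0t" "y \<in> D0t" "F = coeff_matrix x" "G = coeff_matrix y"
    using assms by (auto simp: coeff_matrices_def)
  then show ?thesis using sums_summable[OF coeff_matrix_gstar] by simp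
qed

lemma assoc_algebra_coeff_matrix:
  "assoc_algebra (ring_of_type_algebra :: complex ring) coeff_matrix_algebra"
  unfolding assoc_algebra_def
proof (intro conjI ballI)
  interpret ring coeff_matrix_algebra by (rule ring_coeff_matrix_algebra)
  show "Module.module (ring_of_type_algebra :: complex ring) coeff_matrix_algebra"
    by (rule moduleI[OF cring_from_type_algebra is_abelian_group])
       (simp_all add: ring_of_type_algebra_def coeff_matrix_algebra_def coeff_matrices_scale
          algebra_simps)
next
  fix c and F G
  assume "F \<in> carrier coeff_matrix_algebra" "G \<in> carrier coeff_matrix_algebra"
  then have FG: "summable (\<lambda>j. F k j * G j l)" for k l
    by (simp add: coeff_matrix_algebra_def coeff_matrices_summable)
  show "(c \<odot>\<^bsub>coeff_matrix_algebra\<^esub> F) \<otimes>\<^bsub>coeff_matrix_algebra\<^esub> G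
      = c \<odot>\<^bsub>coeff_matrix_algebra\<^esub> (F \<otimes>\<^bsub>coeff_matrix_algebra\<^esub> G)"
    using suminf_mult[OF FG, of c]
    by (simp add: coeff_matrix_algebra_def mat_mult_def fun_eq_iff mult.assoc)
  show "F \<otimes>\<^bsub>coeff_matrix_algebra\<^esub> (c \<odot>\<^bsub>coeff_matrix_algebra\<^esub> G)
      = c \<odot>\<^bsub>coeff_matrix_algebra\<^esub> (F \<otimes>\<^bsub>coeff_matrix_algebra\<^esub> G)"
    using suminf_mult[OF FG, of c]
    by (simp add: coeff_matrix_algebra_def mat_mult_def fun_eq_iff mult.left_commute)
qed (rule ring_coeff_matrix_algebra)

theorem mainTheorem2:
  shows "(\<forall>F\<in>coeff_matrices. \<forall>G\<in>coeff_matrices. \<forall>k l. summable (\<lambda>j. F k j * G j l)) \<and>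
    assoc_algebra (ring_of_type_algebra :: complex ring) coeff_matrix_algebra \<and>
    Ring.ring D0t_ring \<and>
    coeff_matrix \<in> ring_iso D0t_ring coeff_matrix_algebra"
  using coeff_matrices_summable assoc_algebra_coeff_matrix ring_D0t coeff_matrix_ring_iso by blast

end
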